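(* Let $G$ be a compact Abelian group. Then spectral synthesis holds on $G$.
   Context: Compact Abelian groups are Hausdorff. For a locally compact (in particular, compact) Abelian group $G$, let $C(G)$ be the space of all continuous complex valued functions on $G$, equipped with the topology of uniform convergence on compact sets (for compact $G$ this is the topology of uniform convergence). A variety on $G$ is a closed linear subspace $V$ of $C(G)$ that is translation invariant, i.e. for every $f\in V$ and $y\in G$ the function $x\mapsto f(x+y)$ belongs to $V$. A subvariety of a variety $V$ is a variety contained in $V$. A variety $V$ is called synthesizable if its finite dimensional subvarieties span a dense subspace of $V$, i.e. the linear span of the union of all finite dimensional subvarieties of $V$ is dense in $V$. Spectral synthesis holds for a variety if every subvariety of it is synthesizable. Spectral synthesis holds on $G$ if it holds for every variety on $G$, equivalently if every variety on $G$ is synthesizable. *)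

theory Defs
  imports "HOL-Analysis.Analysis" "HOL-Library.Function_Algebras"
begin

text \<open>The complex vector space of all functions \<open>'a \<Rightarrow> complex\<close>, with pointwise operations.\<close>

global_interpretation cfun: vector_space "\<lambda>(c::complex) (f::'a \<Rightarrow> complex) x. c * f x"
  by standard (simp_all add: fun_eq_iff algebra_simps)

definition cont_funs :: "('a::topological_space \<Rightarrow> complex) set" where
  "cont_funs = {f. continuous_on UNIV f}"

text \<open>Uniform convergence on compact sets. The sets
  \<open>{g \<in> cont_funs. \<forall>x\<in>K. dist (g x) (f x) < e}\<close> form a neighbourhood base at \<open>f\<close>;
  they are directed, so no finite intersections have to be added.\<close>

definition cont_funs_topology :: "('a::topological_space \<Rightarrow> complex) topology" where
  "cont_funs_topology = topology (\<lambda>U. U \<subseteq> cont_funs \<and>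
     (\<forall>f\<in>U. \<exists>K e. compact K \<and> e > 0 \<and>
        {g \<in> cont_funs. \<forall>x\<in>K. dist (g x) (f x) < e} \<subseteq> U))"

lemma openin_cont_funs_topology:
  fixes U :: "('a::topological_space \<Rightarrow> complex) set"
  shows "openin cont_funs_topology U \<longleftrightarrow> U \<subseteq> cont_funs \<and>
     (\<forall>f\<in>U. \<exists>K e. compact K \<and> e > 0 \<and>
        {g \<in> cont_funs. \<forall>x\<in>K. dist (g x) (f x) < e} \<subseteq> U)"
proof -
  define B where "B K e f = {g \<in> cont_funs. \<forall>x\<in>K. dist (g x) (f x) < e}"
    for K :: "'a set" and e :: real and f :: "'a \<Rightarrow> complex"
  define P where "P U \<longleftrightarrow> U \<subseteq> cont_funs \<and>
      (\<forall>f\<in>U. \<exists>K e. compact K \<and> e > 0 \<and> B K e f \<subseteq> U)"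
    for U :: "('a \<Rightarrow> complex) set"
  have "istopology P"
    unfolding istopology_def
  proof (intro conjI allI impI)
    fix S T assume S: "P S" and T: "P T"
    show "P (S \<inter> T)"
      unfolding P_def
    proof (intro conjI ballI)
      show "S \<inter> T \<subseteq> cont_funs"
        using S by (auto simp: P_def)
      fix f assume f: "f \<in> S \<inter> T"
      obtain K d where K: "compact K" "d > 0" "B K d f \<subseteq> S"
        using S f unfolding P_def by (meson IntD1)
      obtain L e where L: "compact L" "e > 0" "B L e f \<subseteq> T"
        using T f unfolding P_def by (meson IntD2)
      have "B (K \<union> L) (min d e) f \<subseteq> B K d f \<inter> B L e f"
        by (auto simp: B_def)
      then have "compact (K \<union> L) \<and> min d e > 0 \<and> B (K \<union> L) (min d e) f \<subseteq> S \<inter> T"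
        using K L by (auto intro: compact_Un)
      then show "\<exists>K e. compact K \<and> e > 0 \<and> B K e f \<subseteq> S \<inter> T"
        by blast
    qed
  next
    fix \<U> assume U: "\<forall>U\<in>\<U>. P U"
    show "P (\<Union>\<U>)"
      unfolding P_def
    proof (intro conjI ballI)
      show "\<Union>\<U> \<subseteq> cont_funs"
        using U by (auto simp: P_def)
      fix f assume "f \<in> \<Union>\<U>"
      then obtain U where "U \<in> \<U>" "f \<in> U" by blast
      moreover then obtain K e where "compact K" "e > 0" "B K e f \<subseteq> U"
        using U unfolding P_def by meson
      ultimately show "\<exists>K e. compact K \<and> e > 0 \<and> B K e f \<subseteq> \<Union>\<U>"
        by blast
    qed
  qed
  moreover have "cont_funs_topology = topology P"
    unfolding cont_funs_topology_def P_def B_def ..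
  ultimately have "openin cont_funs_topology = P"
    using topology_inverse' by metis
  then show ?thesis
    by (simp only: P_def B_def)
qed

lemma topspace_cont_funs_topology [simp]: "topspace cont_funs_topology = cont_funs"
proof
  show "topspace cont_funs_topology \<subseteq> cont_funs"
    using openin_topspace openin_cont_funs_topology by blast
  have "openin cont_funs_topology cont_funs"
    unfolding openin_cont_funs_topology
    using compact_empty zero_less_one by blast
  then show "cont_funs \<subseteq> topspace cont_funs_topology"
    by (rule openin_subset)
qed

definition variety :: "('a::topological_ab_group_add \<Rightarrow> complex) set \<Rightarrow> bool" where
  "variety V \<longleftrightarrow> cfun.subspace V \<and> closedin cont_funs_topology V \<and>
     (\<forall>f\<in>V. \<forall>y. (\<lambda>x. f (x + y)) \<in> V)"

definition subvariety ::
  "('a::topological_ab_group_add \<Rightarrow> complex) set \<Rightarrow> ('a \<Rightarrow> complex) set \<Rightarrow> bool" where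
  "subvariety W V \<longleftrightarrow> variety W \<and> W \<subseteq> V"

definition finite_dimensional :: "('a \<Rightarrow> complex) set \<Rightarrow> bool" where
  "finite_dimensional V \<longleftrightarrow> (\<exists>B. finite B \<and> cfun.span B = V)"

definition synthesizable :: "('a::topological_ab_group_add \<Rightarrow> complex) set \<Rightarrow> bool" where
  "synthesizable V \<longleftrightarrow>
     subtopology cont_funs_topology V closure_of
       cfun.span (\<Union>{W. subvariety W V \<and> finite_dimensional W}) = V"

definition spectral_synthesis_for ::
  "('a::topological_ab_group_add \<Rightarrow> complex) set \<Rightarrow> bool" where
  "spectral_synthesis_for V \<longleftrightarrow> (\<forall>W. subvariety W V \<longrightarrow> synthesizable W)"

definition spectral_synthesis_on :: "'a::topological_ab_group_add itself \<Rightarrow> bool" where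
  "spectral_synthesis_on G \<longleftrightarrow>
     (\<forall>V :: ('a \<Rightarrow> complex) set. variety V \<longrightarrow> spectral_synthesis_for V)"

end

theory Submission
  imports Defs
begin

text \<open>
  Let \<open>V\<close> be a variety on the compact abelian group \<open>G\<close> and \<open>f \<in> V\<close>. It suffices to approximate
  \<open>f\<close> uniformly by elements of finite dimensional subvarieties of \<open>V\<close>. The proof is the
  Peter-Weyl argument carried out inside \<open>V\<close>.

  The invariant mean. Averages of finitely many translates of a continuous function come uniformly
  close to a constant (\<open>has_mean_real_exists\<close>): an average whose supremum is nearly as small as
  possible must be nearly constant, because otherwise finitely many further translates would lower
  its supremum. Averages commute since the group is abelian, so the constant is unique.
  This gives a translation invariant mean, which stands in for Haar integration. Fubini's theorem
  (\<open>mean_fubini\<close>) holds because one average serves all sections of a continuous function of two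
  variables at once (\<open>uniform_mean_approximation\<close>). The mean defines an inner product on the
  continuous functions.

  The operator. Convolution with a continuous even real kernel commutes with translations, is
  self-adjoint, maps every variety into itself, and maps the unit ball of the inner product norm to
  a uniformly bounded equicontinuous family; by Arzela-Ascoli it is compact into the supremum norm.
  The space of continuous functions is in general incomplete for the inner product norm, but this
  does no harm: the compactness produces the limits in the supremum norm, in which \<open>V\<close> is closed.
  Hence on every uniformly closed invariant subspace where it does not vanish, the operator attains
  its norm, at an eigenvector of its square (\<open>eigenvector_exists\<close>).

  The decomposition. Let \<open>\<epsilon> > 0\<close>. By Bessel's inequality an orthonormal set of eigenvectors in \<open>V\<close>
  of the squared operator with eigenvalues at least \<open>\<epsilon>\<^sup>2\<close> has bounded size. For such a set \<open>B\<close> of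
  largest size, the span of \<open>B\<close> contains every eigenvector of this kind; as translates of
  eigenvectors are eigenvectors, the span is a finite dimensional subvariety of \<open>V\<close>. On the
  orthogonal complement of \<open>B\<close> in \<open>V\<close> the operator has norm at most \<open>\<epsilon>\<close>, since
  a larger norm would be attained at an eigenvector orthogonal to \<open>B\<close>
  (\<open>spectral_decomposition\<close>).

  The conclusion. Choose the kernel concentrated where translation moves \<open>f\<close> by at most \<open>e\<close>
  (\<open>approximate_identity\<close>). Applying the operator twice then changes \<open>f\<close> by at most \<open>2 * e\<close>. Write
  \<open>f = p + w\<close> with \<open>p\<close> in the span of \<open>B\<close> and \<open>w\<close> orthogonal to \<open>B\<close>. The operator applied twice
  to \<open>w\<close> is uniformly small, the first application giving the factor \<open>\<epsilon>\<close> and the second turning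
  the inner product norm into the supremum norm, while applied twice to \<open>p\<close> it stays in the span.
\<close>

section \<open>Averages of translates\<close>

text \<open>The translates form a list, with possible repetitions, so that a composite of averages is again an
  average.\<close>

definition avg :: "'a::ab_group_add list \<Rightarrow> ('a \<Rightarrow> 'b::real_vector) \<Rightarrow> 'a \<Rightarrow> 'b" where
  "avg ys f x = (\<Sum>y\<leftarrow>ys. f (x + y)) /\<^sub>R real (length ys)"

text \<open>The product of two lists in the group ring; \<open>avg\<close> turns it into composition of operators.\<close>

definition pairwise_sums :: "'a::ab_group_add list \<Rightarrow> 'a list \<Rightarrow> 'a list" where
  "pairwise_sums xs ys = concat (map (\<lambda>x. map ((+) x) ys) xs)"

lemma pairwise_sums_eq_Nil [simp]: "pairwise_sums xs ys = [] \<longleftrightarrow> xs = [] \<or> ys = []"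
  by (auto simp: pairwise_sums_def)

lemma length_pairwise_sums [simp]: "length (pairwise_sums xs ys) = length xs * length ys"
  by (induction xs) (auto simp: pairwise_sums_def)

lemma avg_pairwise_sums: "avg (pairwise_sums xs ys) f = avg xs (avg ys f)"
proof
  fix z
  have "(\<Sum>w\<leftarrow>pairwise_sums xs ys. f (z + w)) = (\<Sum>x\<leftarrow>xs. \<Sum>y\<leftarrow>ys. f (z + x + y))"
    by (induction xs) (simp_all add: pairwise_sums_def o_def add.assoc)
  moreover have "(\<Sum>x\<leftarrow>xs. (g x :: 'b) /\<^sub>R r) = (\<Sum>x\<leftarrow>xs. g x) /\<^sub>R r" for g :: "'a \<Rightarrow> 'b" and r
    by (induction xs) (simp_all add: scaleR_add_right)
  ultimately show "avg (pairwise_sums xs ys) f z = avg xs (avg ys f) z"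
    by (simp add: avg_def)
qed

lemma avg_commute: "avg xs (avg ys f) = avg ys (avg xs f)"
proof
  fix z
  have swap: "(\<Sum>x\<leftarrow>xs. \<Sum>y\<leftarrow>ys. (g x y :: 'b)) = (\<Sum>y\<leftarrow>ys. \<Sum>x\<leftarrow>xs. g x y)" for g
    by (induction xs) (simp_all add: sum_list_addf)
  have "(\<Sum>w\<leftarrow>pairwise_sums xs ys. f (z + w)) = (\<Sum>w\<leftarrow>pairwise_sums ys xs. f (z + w))"
  proof -
    have *: "(\<Sum>w\<leftarrow>pairwise_sums us vs. f (z + w)) = (\<Sum>x\<leftarrow>us. \<Sum>y\<leftarrow>vs. f (z + (x + y)))" for us vs
      by (induction us) (simp_all add: pairwise_sums_def o_def)
    show ?thesis unfolding * by (subst swap) (simp add: add.commute)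
  qed
  then show "avg xs (avg ys f) z = avg ys (avg xs f) z"
    by (simp flip: avg_pairwise_sums add: avg_def mult.commute)
qed

lemma avg_linear:
  assumes "linear L"
  shows "L (avg ys f x) = avg ys (\<lambda>x. L (f x)) x"
proof -
  have "L (\<Sum>y\<leftarrow>ys. f (x + y)) = (\<Sum>y\<leftarrow>ys. L (f (x + y)))"
    by (induction ys) (simp_all add: linear_add[OF assms] linear_0[OF assms])
  then show ?thesis by (simp add: avg_def linear_cmul[OF assms])
qed

lemma avg_add: "avg ys (\<lambda>x. f x + g x) x = avg ys f x + avg ys g x"
  by (simp add: avg_def sum_list_addf scaleR_add_right)

lemma avg_minus: "avg ys (\<lambda>x. - f x) x = - avg ys f x"
  by (rule avg_linear[symmetric]) (simp add: linear_iff)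

lemma avg_diff: "avg ys (\<lambda>x. f x - g x) x = avg ys f x - avg ys g x"
  using avg_add[of ys f "\<lambda>x. - g x" x] by (simp add: avg_minus)

lemma avg_const [simp]: "ys \<noteq> [] \<Longrightarrow> avg ys (\<lambda>_. c) x = c"
proof -
  assume "ys \<noteq> []"
  moreover have "(\<Sum>y\<leftarrow>ys. c) = real (length ys) *\<^sub>R c"
    by (induction ys) (simp_all add: scaleR_add_left)
  ultimately show ?thesis by (simp add: avg_def)
qed

lemma avg_mono:
  fixes f g :: "'a::ab_group_add \<Rightarrow> real"
  assumes "\<And>x. f x \<le> g x"
  shows "avg ys f x \<le> avg ys g x"
  unfolding avg_def using assms by (auto intro!: divide_right_mono sum_list_mono simp: divide_inverse_commute[symmetric])

lemma norm_avg_le: "norm (avg ys f x) \<le> avg ys (\<lambda>x. norm (f x)) x"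
proof -
  have "norm (\<Sum>y\<leftarrow>ys. f (x + y)) \<le> (\<Sum>y\<leftarrow>ys. norm (f (x + y)))"
    by (induction ys) (auto intro: norm_triangle_le)
  then show ?thesis by (simp add: avg_def divide_right_mono divide_inverse_commute[symmetric])
qed

lemma norm_avg_le_const:
  assumes "ys \<noteq> []" "\<And>x. norm (f x) \<le> e"
  shows "norm (avg ys f x) \<le> e"
  using norm_avg_le[of ys f x] avg_mono[of "\<lambda>x. norm (f x)" "\<lambda>_. e" ys x] assms by simp

lemma avg_close:
  assumes "ys \<noteq> []" "\<And>x. norm (f x - c) \<le> e"
  shows "norm (avg ys f x - c) \<le> e"
  using norm_avg_le_const[OF assms(1), of "\<lambda>x. f x - c" e x] assms by (simp add: avg_diff)

lemma avg_translate: "avg ys (\<lambda>x. f (x + t)) x = avg ys f (x + t)"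
  by (simp add: avg_def ac_simps)

section \<open>Invariant means\<close>

definition has_mean :: "('a::ab_group_add \<Rightarrow> 'b::real_normed_vector) \<Rightarrow> 'b \<Rightarrow> bool" where
  "has_mean f c \<longleftrightarrow> (\<forall>e>0. \<exists>ys. ys \<noteq> [] \<and> (\<forall>x. norm (avg ys f x - c) \<le> e))"

definition mean :: "('a::ab_group_add \<Rightarrow> 'b::real_normed_vector) \<Rightarrow> 'b" where
  "mean f = (THE c. has_mean f c)"

lemma has_meanD:
  assumes "has_mean f c" "e > 0"
  obtains ys where "ys \<noteq> []" "\<And>x. norm (avg ys f x - c) \<le> e"
  using assms unfolding has_mean_def by blast

text \<open>Composing with a further average, on either side, does not spoil an approximation. This is the
  tool for approximating several means by one and the same average. On one of the sides it needs
  that averages commute; here the commutativity of the group enters.\<close>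

lemma pairwise_sums_close:
  assumes "ys \<noteq> []" "\<And>x. norm (avg xs f x - c) \<le> e"
  shows "norm (avg (pairwise_sums xs ys) f x - c) \<le> e" "norm (avg (pairwise_sums ys xs) f x - c) \<le> e"
proof -
  show "norm (avg (pairwise_sums ys xs) f x - c) \<le> e"
    unfolding avg_pairwise_sums by (rule avg_close) (use assms in auto)
  then show "norm (avg (pairwise_sums xs ys) f x - c) \<le> e"
    unfolding avg_pairwise_sums by (simp add: avg_commute)
qed

lemma has_mean_pair:
  assumes "has_mean f a" "has_mean g b" "e > 0"
  obtains ys where "ys \<noteq> []" "\<And>x. norm (avg ys f x - a) \<le> e" "\<And>x. norm (avg ys g x - b) \<le> e"
proof -
  obtain xs where xs: "xs \<noteq> []" "\<And>x. norm (avg xs f x - a) \<le> e"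
    using has_meanD[OF assms(1,3)] by blast
  obtain ys where ys: "ys \<noteq> []" "\<And>x. norm (avg ys g x - b) \<le> e"
    using has_meanD[OF assms(2,3)] by blast
  show thesis
    by (rule that[of "pairwise_sums xs ys"])
      (use xs(1) ys(1) in \<open>auto intro: pairwise_sums_close xs(2) ys(2)\<close>)
qed

text \<open>The composite of all the averages belonging to the single members works.\<close>

lemma has_mean_family:
  assumes "finite I" "\<And>i. i \<in> I \<Longrightarrow> has_mean (f i) (c i)" "e > 0"
  shows "\<exists>ys. ys \<noteq> [] \<and> (\<forall>i\<in>I. \<forall>x. norm (avg ys (f i) x - c i) \<le> e)"
  using assms(1,2)
proof (induction I)
  case empty
  show ?case by (rule exI[of _ "[0]"]) simp
next
  case (insert j I)
  obtain ys where ys: "ys \<noteq> []" "\<forall>i\<in>I. \<forall>x. norm (avg ys (f i) x - c i) \<le> e"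
    using insert by auto
  obtain xs where xs: "xs \<noteq> []" "\<And>x. norm (avg xs (f j) x - c j) \<le> e"
    using has_meanD[OF _ assms(3)] insert.prems by (metis insertI1)
  show ?case
    by (rule exI[of _ "pairwise_sums xs ys"])
      (use xs ys pairwise_sums_close(1)[OF ys(1) xs(2)] in \<open>auto intro: pairwise_sums_close(2)\<close>)
qed

lemma has_mean_unique:
  assumes "has_mean f a" "has_mean f b"
  shows "a = b"
proof (rule ccontr)
  assume "a \<noteq> b"
  then have "norm (a - b) / 4 > 0" by simp
  then obtain ys where ys: "ys \<noteq> []" "\<And>x. norm (avg ys f x - a) \<le> norm (a - b) / 4"
      "\<And>x. norm (avg ys f x - b) \<le> norm (a - b) / 4"
    using has_mean_pair[OF assms] by metis
  have "norm (a - b) \<le> norm (avg ys f 0 - b) + norm (avg ys f 0 - a)"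
    using norm_triangle_ineq4[of "avg ys f 0 - b" "avg ys f 0 - a"] by simp
  moreover have "norm (a - b) > 0" using \<open>a \<noteq> b\<close> by simp
  ultimately show False using ys(2)[of 0] ys(3)[of 0] by linarith
qed

lemma mean_eqI: "has_mean f c \<Longrightarrow> mean f = c"
  unfolding mean_def by (rule the_equality) (auto intro: has_mean_unique)

lemma has_mean_const: "has_mean (\<lambda>_. c) c"
  unfolding has_mean_def by (auto intro!: exI[of _ "[0]"])

lemma has_mean_add:
  assumes "has_mean f a" "has_mean g b"
  shows "has_mean (\<lambda>x. f x + g x) (a + b)"
  unfolding has_mean_def
proof (intro allI impI)
  fix e :: real assume "e > 0"
  then obtain ys where ys: "ys \<noteq> []" "\<And>x. norm (avg ys f x - a) \<le> e/2"
      "\<And>x. norm (avg ys g x - b) \<le> e/2"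
    using has_mean_pair[OF assms, of "e/2"] by auto
  have "norm (avg ys (\<lambda>x. f x + g x) x - (a + b)) \<le> e" for x
    using norm_triangle_ineq[of "avg ys f x - a" "avg ys g x - b"] ys(2,3)[of x]
    by (simp add: avg_add algebra_simps)
  then show "\<exists>ys. ys \<noteq> [] \<and> (\<forall>x. norm (avg ys (\<lambda>x. f x + g x) x - (a + b)) \<le> e)"
    using ys(1) by blast
qed

lemma has_mean_bounded_linear:
  assumes L: "bounded_linear L" and f: "has_mean f a"
  shows "has_mean (\<lambda>x. L (f x)) (L a)"
  unfolding has_mean_def
proof (intro allI impI)
  fix e :: real assume e: "e > 0"
  obtain K where K: "K > 0" "\<And>x. norm (L x) \<le> norm x * K"
    using bounded_linear.pos_bounded[OF L] by blast
  obtain ys where ys: "ys \<noteq> []" "\<And>x. norm (avg ys f x - a) \<le> e / K"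
    using has_meanD[OF f, of "e / K"] e K(1) by auto
  have "norm (avg ys (\<lambda>x. L (f x)) x - L a) \<le> e" for x
  proof -
    have "avg ys (\<lambda>x. L (f x)) x - L a = L (avg ys f x - a)"
      using avg_linear[of L ys f x] bounded_linear.linear[OF L] linear_diff by metis
    also have "norm \<dots> \<le> (e / K) * K"
      using K(2)[of "avg ys f x - a"] ys(2)[of x] K(1) by (meson mult_right_mono less_imp_le order_trans)
    finally show ?thesis using K(1) by simp
  qed
  then show "\<exists>ys. ys \<noteq> [] \<and> (\<forall>x. norm (avg ys (\<lambda>x. L (f x)) x - L a) \<le> e)"
    using ys(1) by blast
qed

lemma has_mean_sum:
  assumes "\<And>i. i \<in> I \<Longrightarrow> has_mean (f i) (a i)"
  shows "has_mean (\<lambda>x. \<Sum>i\<in>I. f i x) (\<Sum>i\<in>I. a i)"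
  using assms by (induction I rule: infinite_finite_induct) (auto intro: has_mean_const has_mean_add)

lemma has_mean_translate: "has_mean f a \<Longrightarrow> has_mean (\<lambda>x. f (x + t)) a"
  unfolding has_mean_def avg_translate by metis

lemma has_mean_reflect:
  assumes "has_mean f a"
  shows "has_mean (\<lambda>x. f (- x)) a"
proof -
  have "avg (map uminus ys) (\<lambda>x. f (- x)) x = avg ys f (- x)" for ys x
    by (simp add: avg_def o_def)
  then show ?thesis using assms unfolding has_mean_def by (metis map_is_Nil_conv)
qed

lemma norm_has_mean_le:
  assumes "has_mean f a" "has_mean g b" "\<And>x. norm (f x) \<le> g x"
  shows "norm a \<le> b"
proof (rule field_le_epsilon)
  fix e :: real assume e: "e > 0"
  obtain xs where xs: "xs \<noteq> []" "\<And>x. norm (avg xs f x - a) \<le> e/2"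
    using has_meanD[OF assms(1), of "e/2"] e by auto
  obtain ys where ys: "ys \<noteq> []" "\<And>x. norm (avg ys g x - b) \<le> e/2"
    using has_meanD[OF assms(2), of "e/2"] e by auto
  let ?zs = "pairwise_sums xs ys"
  have 1: "norm (avg ?zs f 0 - a) \<le> e/2" and 2: "norm (avg ?zs g 0 - b) \<le> e/2"
    using pairwise_sums_close xs ys by blast+
  have "norm a \<le> norm (avg ?zs f 0) + e/2"
    using 1 norm_triangle_sub[of a "avg ?zs f 0"] by (simp add: norm_minus_commute)
  also have "norm (avg ?zs f 0) \<le> avg ?zs g 0"
    using norm_avg_le[of ?zs f 0] avg_mono[of "\<lambda>x. norm (f x)" g ?zs 0] assms(3) by simp
  also have "avg ?zs g 0 \<le> b + e/2" using 2 abs_ge_self[of "avg ?zs g 0 - b"] unfolding real_norm_def by linarith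
  finally show "norm a \<le> b + e" by simp
qed

text \<open>The discrete form of Fubini's theorem, with an average in the place of one of the means.\<close>

lemma has_mean_avg:
  assumes "\<And>y. has_mean (\<lambda>x. F x y) (H y)"
  shows "has_mean (\<lambda>x. avg ys (F x) z) (avg ys H z)"
proof -
  have "has_mean (\<lambda>x. \<Sum>y\<leftarrow>ys. F x (z + y)) (\<Sum>y\<leftarrow>ys. H (z + y))"
    by (induction ys) (auto intro: has_mean_const has_mean_add assms)
  then show ?thesis
    unfolding avg_def by (rule has_mean_bounded_linear[OF bounded_linear_scaleR_right])
qed

section \<open>Compact abelian groups\<close>

lemma continuous_section:
  assumes "continuous_on UNIV (\<lambda>p. F (fst p) (snd p))"
  shows "continuous_on UNIV (F x)"
  using continuous_on_compose[of UNIV "Pair x" "\<lambda>p. F (fst p) (snd p)"]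
    continuous_on_subset[OF assms subset_UNIV]
  by (simp add: o_def continuous_on_Pair continuous_on_const continuous_on_id)

lemma continuous_swap:
  assumes "continuous_on UNIV (\<lambda>p. F (fst p) (snd p))"
  shows "continuous_on UNIV (\<lambda>p. F (snd p) (fst p))"
  using continuous_on_compose2[OF assms continuous_on_swap subset_UNIV] by (simp add: prod.swap_def)

text \<open>The parameter \<open>G\<close> only pins down the type; the group is its universe.\<close>

locale compact_ab_group =
  fixes G :: "'a::topological_ab_group_add itself"
  assumes compact_UNIV: "compact (UNIV :: 'a set)"
begin

lemma bounded_cont:
  fixes f :: "'a \<Rightarrow> 'b::real_normed_vector"
  assumes "continuous_on UNIV f"
  obtains C where "C > 0" "\<And>x. norm (f x) \<le> C"
proof -
  have "bounded (range f)"
    using compact_continuous_image[OF assms compact_UNIV] compact_imp_bounded by blast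
  then show ?thesis using that unfolding bounded_pos by blast
qed

text \<open>The tube lemma in metric form.\<close>

lemma uniform_along_compact:
  fixes F :: "'c::topological_space \<Rightarrow> 'a \<Rightarrow> 'b::metric_space"
  assumes "continuous_on UNIV (\<lambda>p. F (fst p) (snd p))" "e > 0"
  obtains U where "open U" "x0 \<in> U" "\<And>x y. x \<in> U \<Longrightarrow> dist (F x y) (F x0 y) \<le> e"
proof -
  have "continuous_on (UNIV \<times> UNIV) (\<lambda>p. F (fst p) (snd p))" using assms(1) by simp
  from this compact_UNIV UNIV_I assms(2)
  obtain U where "x0 \<in> U" "open U" "\<forall>x\<in>U \<inter> UNIV. \<forall>y\<in>UNIV. dist (F x y) (F x0 y) \<le> e"
    unfolding fst_conv snd_conv
    by (rule continuous_on_prod_compactE[where fx = "\<lambda>p. F (fst p) (snd p)",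
          unfolded fst_conv snd_conv])
  then show ?thesis using that[of U] by simp
qed

lemma uniformly_cont:
  fixes f :: "'a \<Rightarrow> 'b::metric_space"
  assumes "continuous_on UNIV f" "e > 0"
  obtains U where "open U" "0 \<in> U" "\<And>x u. u \<in> U \<Longrightarrow> dist (f (x + u)) (f x) \<le> e"
proof -
  have *: "continuous_on UNIV (\<lambda>p. f (snd p + fst p))"
    by (rule continuous_on_compose2[OF assms(1)])
      (intro continuous_on_add continuous_on_fst continuous_on_snd continuous_on_id subset_UNIV)+
  obtain U where U: "open U" "0 \<in> U" "\<And>u x. u \<in> U \<Longrightarrow> dist (f (x + u)) (f (x + 0)) \<le> e"
    by (rule uniform_along_compact[of "\<lambda>u x. f (x + u)" e 0, OF * assms(2)]) (rule that)
  show ?thesis by (rule that[OF U(1,2)]) (use U(3) in simp)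
qed

lemma finite_translates_cover:
  assumes "open U" "(0::'a) \<in> U"
  obtains ys :: "'a list" where "ys \<noteq> []" "\<And>x. \<exists>y\<in>set ys. x + y \<in> U"
proof -
  have op: "open {x. x + y \<in> U}" for y
    using open_vimage[OF assms(1), of "\<lambda>x. x + y"]
    by (simp add: vimage_def continuous_on_add[OF continuous_on_id continuous_on_const])
  have "UNIV \<subseteq> (\<Union>y\<in>UNIV. {x. x + y \<in> U})"
  proof
    fix x :: 'a have "x + - x \<in> U" using assms(2) by simp
    then show "x \<in> (\<Union>y\<in>UNIV. {x. x + y \<in> U})" by blast
  qed
  then obtain Y where Y: "finite Y" "UNIV \<subseteq> (\<Union>y\<in>Y. {x. x + y \<in> U})"
    using compactE_image[OF compact_UNIV, of UNIV "\<lambda>y. {x. x + y \<in> U}"] op by metis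
  then obtain ys where ys: "set ys = Y" using finite_list by blast
  then have cov: "\<exists>y\<in>set ys. x + y \<in> U" for x using Y(2) by blast
  have "ys \<noteq> []" using cov[of 0] by (cases ys) simp_all
  then show ?thesis using that cov by metis
qed

text \<open>The mean is the infimum \<open>m\<close> of the upper bounds of averages of \<open>\<phi>\<close>. Take an average \<open>h\<close> bounded
  by \<open>m + \<delta>\<close>. All averages of \<open>\<phi>\<close> share its modulus of continuity, so if \<open>h\<close> drops below \<open>m - e/2\<close>
  somewhere, it stays below \<open>m - e/4\<close> on a translate of a neighbourhood whose size depends only on
  \<open>e\<close>. Averaging \<open>h\<close> over the \<open>N\<close> translates that cover the group brings at least one such small
  value into every average, which pushes the upper bound below \<open>m\<close> when \<open>\<delta>\<close> is small
  against \<open>e / N\<close>.\<close>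

lemma has_mean_real_exists:
  fixes \<phi> :: "'a \<Rightarrow> real"
  assumes "continuous_on UNIV \<phi>"
  shows "\<exists>m. has_mean \<phi> m"
proof -
  define S where "S = {c. \<exists>ys. ys \<noteq> [] \<and> (\<forall>x. avg ys \<phi> x \<le> c)}"
  define m where "m = Inf S"
  obtain C where C: "C > 0" "\<And>x. norm (\<phi> x) \<le> C" by (rule bounded_cont[OF assms]) (rule that)
  have lowC: "- C \<le> avg ys \<phi> x" if "ys \<noteq> []" for ys x
    using norm_avg_le_const[where f = \<phi> and x = x, OF that C(2)] by (simp add: abs_le_iff)
  have bdd: "bdd_below S"
  proof (rule bdd_belowI[of _ "-C"])
    fix c assume "c \<in> S"
    then obtain ys where "ys \<noteq> []" "avg ys \<phi> 0 \<le> c" unfolding S_def by blast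
    then show "- C \<le> c" using lowC[of ys 0] by linarith
  qed
  have "\<forall>x. avg [0] \<phi> x \<le> C"
    using C(2) by (simp add: avg_def abs_le_iff)
  then have "C \<in> S" unfolding S_def by blast
  then have ne: "S \<noteq> {}" by blast
  have "has_mean \<phi> m"
    unfolding has_mean_def
  proof (intro allI impI)
    fix e :: real assume e: "e > 0"
    obtain U where U: "open U" "0 \<in> U" "\<And>x u. u \<in> U \<Longrightarrow> dist (\<phi> (x + u)) (\<phi> x) \<le> e/4"
      by (rule uniformly_cont[OF assms, of "e/4"]) (use e in simp, rule that)
    obtain zs where zs: "zs \<noteq> []" "\<And>x. \<exists>z\<in>set zs. x + z \<in> U"
      by (rule finite_translates_cover[OF U(1,2)]) (rule that)
    define N where "N = real (length zs)"
    have N: "N \<ge> 1" using zs(1) unfolding N_def by (cases zs) auto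
    \<comment> \<open>the other \<open>N - 1\<close> terms exceed \<open>m\<close> by less than \<open>e/8\<close> in total, against a gain of \<open>e/4\<close>\<close>
    define \<delta> where "\<delta> = e / (8 * N)"
    have \<delta>: "\<delta> > 0" "N * \<delta> = e / 8" "\<delta> \<le> e"
      using e N by (auto simp: \<delta>_def field_simps)
    obtain ys where ys: "ys \<noteq> []" "\<And>x. avg ys \<phi> x \<le> m + \<delta>"
    proof -
      have "Inf S < m + \<delta>" using \<delta>(1) by (simp add: m_def)
      then obtain c where "c \<in> S" "c < m + \<delta>" using cInf_lessD[OF ne] by blast
      then obtain ys where "ys \<noteq> []" "\<forall>x. avg ys \<phi> x \<le> c" unfolding S_def by blast
      moreover have "avg ys \<phi> x \<le> m + \<delta>" for x
        using calculation(2)[rule_format, of x] \<open>c < m + \<delta>\<close> by linarith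
      ultimately show ?thesis by (intro that)
    qed
    define h where "h = avg ys \<phi>"
    have equi: "\<bar>h (x + u) - h x\<bar> \<le> e/4" if "u \<in> U" for x u
    proof -
      have "h (x + u) - h x = avg ys (\<lambda>x. \<phi> (x + u) - \<phi> x) x"
        unfolding h_def by (simp add: avg_diff avg_translate)
      then show ?thesis
        using norm_avg_le_const[OF ys(1), of "\<lambda>x. \<phi> (x + u) - \<phi> x" "e/4" x] U(3)[OF that]
        by (simp add: dist_real_def)
    qed
    have low: "m - e/2 \<le> h x0" for x0
    proof (rule ccontr)
      assume "\<not> m - e/2 \<le> h x0"
      then have x0: "h x0 < m - e/2" by simp
      have up: "avg zs h x \<le> m - \<delta>" for x
      proof -
        obtain z where z: "z \<in> set zs" "(x - x0) + z \<in> U" using zs(2) by blast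
        have "h (x0 + ((x - x0) + z)) \<le> h x0 + e/4" using equi[OF z(2), of x0] by linarith
        then have hz: "h (x + z) \<le> m - e/4" using x0 by (simp add: algebra_simps)
        have "(\<Sum>y\<leftarrow>zs. h (x + y)) = h (x + z) + (\<Sum>y\<leftarrow>remove1 z zs. h (x + y))"
          using z(1) by (rule sum_list_map_remove1)
        also have "\<dots> \<le> (m - e/4) + (\<Sum>y\<leftarrow>remove1 z zs. m + \<delta>)"
          using hz ys(2) by (intro add_mono sum_list_mono) (auto simp: h_def)
        also have "(\<Sum>y\<leftarrow>remove1 z zs. m + \<delta>) = (N - 1) * (m + \<delta>)"
          using z(1) N of_nat_diff[of 1 "length zs", where ?'a = real]
          by (simp add: sum_list_triv length_remove1 N_def)
        finally have "(\<Sum>y\<leftarrow>zs. h (x + y)) \<le> N * m - \<delta> + N * \<delta> - e/4"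
          by (simp add: algebra_simps)
        also have "\<dots> \<le> N * (m - \<delta>)" using \<delta> by (simp add: algebra_simps)
        finally have "(\<Sum>y\<leftarrow>zs. h (x + y)) / N \<le> m - \<delta>" using N by (simp add: field_simps)
        then show ?thesis by (simp add: avg_def N_def divide_inverse_commute)
      qed
      have "m - \<delta> \<in> S"
        unfolding S_def mem_Collect_eq
        by (rule exI[of _ "pairwise_sums zs ys"]) (use up zs(1) ys(1) in \<open>simp add: avg_pairwise_sums h_def\<close>)
      then have "m \<le> m - \<delta>" unfolding m_def using cInf_lower[OF _ bdd] by blast
      then show False using \<delta>(1) by simp
    qed
    have "\<bar>h x - m\<bar> \<le> e" for x
      using low[of x] ys(2)[of x] \<delta>(3) e unfolding h_def[symmetric] by linarith
    then show "\<exists>ys. ys \<noteq> [] \<and> (\<forall>x. norm (avg ys \<phi> x - m) \<le> e)"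
      using ys(1) by (auto simp: h_def)
  qed
  then show ?thesis ..
qed

lemma has_mean_mean:
  fixes f :: "'a \<Rightarrow> 'b::euclidean_space"
  assumes "continuous_on UNIV f"
  shows "has_mean f (mean f)"
proof -
  have "\<exists>m. has_mean (\<lambda>x. f x \<bullet> b) m" for b
    by (rule has_mean_real_exists) (intro continuous_intros assms)
  then obtain m where m: "\<And>b. has_mean (\<lambda>x. f x \<bullet> b) (m b)" by metis
  have "has_mean (\<lambda>x. \<Sum>b\<in>Basis. (f x \<bullet> b) *\<^sub>R b) (\<Sum>b\<in>Basis. m b *\<^sub>R b)"
    by (intro has_mean_sum has_mean_bounded_linear[OF bounded_linear_scaleR_left m])
  then have "has_mean f (\<Sum>b\<in>Basis. m b *\<^sub>R b)" by (simp add: euclidean_representation)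
  then show ?thesis using mean_eqI by metis
qed

lemma mean_const [simp]: "mean (\<lambda>_::'a. c) = c"
  by (rule mean_eqI[OF has_mean_const])

lemma mean_add:
  fixes f g :: "'a \<Rightarrow> 'b::euclidean_space"
  assumes f: "continuous_on UNIV f" and g: "continuous_on UNIV g"
  shows "mean (\<lambda>x. f x + g x) = mean f + mean g"
  by (rule mean_eqI[OF has_mean_add[OF has_mean_mean[OF f] has_mean_mean[OF g]]])

context
  fixes f :: "'a \<Rightarrow> 'b::euclidean_space"
  assumes f: "continuous_on UNIV f"
begin

lemma mean_bounded_linear: "bounded_linear L \<Longrightarrow> mean (\<lambda>x. L (f x)) = L (mean f)"
  by (rule mean_eqI[OF has_mean_bounded_linear[OF _ has_mean_mean[OF f]]])

lemma mean_translate: "mean (\<lambda>x. f (x + t)) = mean f"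
  by (rule mean_eqI[OF has_mean_translate[OF has_mean_mean[OF f]]])

lemma mean_reflect: "mean (\<lambda>x. f (- x)) = mean f"
  by (rule mean_eqI[OF has_mean_reflect[OF has_mean_mean[OF f]]])

end

lemma mean_diff:
  fixes f g :: "'a \<Rightarrow> 'b::euclidean_space"
  assumes f: "continuous_on UNIV f" and g: "continuous_on UNIV g"
  shows "mean (\<lambda>x. f x - g x) = mean f - mean g"
  using mean_add[OF f continuous_on_minus[OF g]]
    mean_bounded_linear[OF g bounded_linear_minus[OF bounded_linear_ident]] by simp

lemma norm_mean_le:
  fixes f :: "'a \<Rightarrow> 'b::euclidean_space"
  assumes "continuous_on UNIV f" "continuous_on UNIV g" "\<And>x. norm (f x) \<le> g x"
  shows "norm (mean f) \<le> mean g"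
  by (rule norm_has_mean_le[OF has_mean_mean has_mean_mean]) (use assms in auto)

lemma norm_mean_diff_le:
  fixes f g :: "'a \<Rightarrow> 'b::euclidean_space"
  assumes f: "continuous_on UNIV f" and g: "continuous_on UNIV g"
    and le: "\<And>x. norm (f x - g x) \<le> e"
  shows "norm (mean f - mean g) \<le> e"
proof -
  have "norm (mean (\<lambda>x. f x - g x)) \<le> mean (\<lambda>x::'a. e)"
    by (rule norm_mean_le[OF continuous_on_diff[OF f g] continuous_on_const le])
  then show ?thesis by (simp add: mean_diff[OF f g])
qed

lemma mean_mono:
  fixes f g :: "'a \<Rightarrow> real"
  assumes f: "continuous_on UNIV f" and g: "continuous_on UNIV g" and le: "\<And>x. f x \<le> g x"
  shows "mean f \<le> mean g"
proof -
  have "norm (mean (\<lambda>x::'a. 0::real)) \<le> mean (\<lambda>x. g x - f x)"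
    by (rule norm_mean_le) (use assms in \<open>auto intro!: continuous_intros\<close>)
  then show ?thesis by (simp add: mean_diff[OF g f])
qed

text \<open>Finitely many translates of a neighbourhood of \<open>x0\<close> where \<open>f\<close> is at least half of \<open>f x0\<close> cover the group,
  so some average of \<open>f\<close> has a positive lower bound. This makes the inner product below definite.\<close>

lemma mean_pos:
  fixes f :: "'a \<Rightarrow> real"
  assumes f: "continuous_on UNIV f" and nn: "\<And>x. f x \<ge> 0" and pos: "f x0 > 0"
  shows "mean f > 0"
proof -
  obtain U where U: "open U" "0 \<in> U" "\<And>x u. u \<in> U \<Longrightarrow> dist (f (x + u)) (f x) \<le> f x0 / 2"
    by (rule uniformly_cont[OF f, of "f x0 / 2"]) (use pos in simp, rule that)
  obtain ys where ys: "ys \<noteq> []" "\<And>x. \<exists>y\<in>set ys. x + y \<in> U"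
    by (rule finite_translates_cover[OF U(1,2)]) (rule that)
  let ?N = "real (length ys)"
  have N: "?N > 0" using ys(1) by simp
  define c where "c = f x0 / 2 / ?N"
  have c: "c > 0" using pos N by (simp add: c_def)
  have le: "norm c \<le> avg ys f x" for x
  proof -
    obtain y where y: "y \<in> set ys" "(x - x0) + y \<in> U" using ys(2) by blast
    have "f x0 / 2 \<le> f (x + y)"
    proof -
      have "\<bar>f (x + y) - f x0\<bar> \<le> f x0 / 2"
        using U(3)[OF y(2), of x0] by (simp add: dist_real_def algebra_simps)
      then show ?thesis by linarith
    qed
    also have "\<dots> \<le> (\<Sum>y\<leftarrow>ys. f (x + y))"
      using y(1) nn by (intro member_le_sum_list) auto
    finally show ?thesis using N c by (simp add: avg_def c_def field_simps)
  qed
  have "has_mean (avg ys f) (mean f)"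
  proof -
    have "(\<lambda>x. avg ys (\<lambda>y. f (x + y)) 0) = avg ys f" by (simp add: avg_def fun_eq_iff)
    then show ?thesis
      using has_mean_avg[where F = "\<lambda>x y. f (x + y)" and ys = ys and z = 0,
          OF has_mean_translate[OF has_mean_mean[OF f]]]
      by (simp only: avg_const[OF ys(1)])
  qed
  from norm_has_mean_le[OF has_mean_const this le] have "norm c \<le> mean f" .
  then show ?thesis using c by simp
qed

text \<open>By compactness the sections \<open>F x\<close> are uniformly close to finitely many of them, and a single
  average serves these.\<close>

lemma uniform_mean_approximation:
  fixes F :: "'a \<Rightarrow> 'a \<Rightarrow> 'b::euclidean_space"
  assumes F: "continuous_on UNIV (\<lambda>p. F (fst p) (snd p))" and e: "e > 0"
  obtains ys where "ys \<noteq> []" "\<And>x z. norm (avg ys (F x) z - mean (F x)) \<le> e"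
proof -
  have Fx: "continuous_on UNIV (F x)" for x
    by (rule continuous_section[OF F])
  have "\<exists>U. open U \<and> x0 \<in> U \<and> (\<forall>x\<in>U. \<forall>y. dist (F x y) (F x0 y) \<le> e/3)" for x0
    by (rule uniform_along_compact[OF F, of "e/3" x0]) (use e in simp, blast)
  from choice[OF allI[OF this]] obtain U where U: "\<forall>x0. open (U x0) \<and> x0 \<in> U x0 \<and>
      (\<forall>x\<in>U x0. \<forall>y. dist (F x y) (F x0 y) \<le> e/3)" ..
  have "UNIV \<subseteq> \<Union> (range U)" using U by blast
  then obtain \<D> where \<D>: "\<D> \<subseteq> range U" "finite \<D>" "UNIV \<subseteq> \<Union> \<D>"
    by (rule compactE[OF compact_UNIV]) (use U in blast)
  then obtain D where D: "finite D" "\<D> = U ` D"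
    using finite_subset_image[OF \<D>(2,1)] by blast
  obtain ys where ys: "ys \<noteq> []" "\<And>x z. x \<in> D \<Longrightarrow> norm (avg ys (F x) z - mean (F x)) \<le> e/3"
    using has_mean_family[OF D(1), of F "\<lambda>x. mean (F x)" "e/3"] has_mean_mean[OF Fx] e by auto
  have "norm (avg ys (F x) z - mean (F x)) \<le> e" for x z
  proof -
    obtain x0 where x0: "x0 \<in> D" "x \<in> U x0" using D(2) \<D>(3) by blast
    have d: "norm (F x y - F x0 y) \<le> e/3" for y using U x0(2) by (simp add: dist_norm)
    have "norm (avg ys (F x) z - avg ys (F x0) z) \<le> e/3"
      using norm_avg_le_const[where f = "\<lambda>y. F x y - F x0 y" and x = z, OF ys(1) d]
      by (simp add: avg_diff)
    moreover have "norm (mean (F x) - mean (F x0)) \<le> e/3"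
      by (rule norm_mean_diff_le[OF Fx Fx d])
    ultimately show ?thesis using ys(2)[OF x0(1), of z]
      using norm_triangle_ineq[of "avg ys (F x) z - avg ys (F x0) z" "avg ys (F x0) z - mean (F x)"]
        norm_triangle_ineq[of "avg ys (F x0) z - mean (F x0)" "mean (F x0) - mean (F x)"]
      by (simp add: norm_minus_commute)
  qed
  then show ?thesis using that ys(1) by blast
qed

lemma continuous_mean_param:
  fixes F :: "'a \<Rightarrow> 'a \<Rightarrow> 'b::euclidean_space"
  assumes F: "continuous_on UNIV (\<lambda>p. F (fst p) (snd p))"
  shows "continuous_on UNIV (\<lambda>x. mean (F x))"
proof -
  have Fx: "continuous_on UNIV (F x)" for x
    by (rule continuous_section[OF F])
  have "((\<lambda>x. mean (F x)) \<longlongrightarrow> mean (F x0)) (at x0)" for x0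
    unfolding tendsto_iff
  proof (intro allI impI)
    fix e :: real assume e: "e > 0"
    obtain U where U: "open U" "x0 \<in> U" "\<And>x y. x \<in> U \<Longrightarrow> dist (F x y) (F x0 y) \<le> e/2"
      by (rule uniform_along_compact[OF F, of "e/2" x0]) (use e in simp, rule that)
    have "dist (mean (F x)) (mean (F x0)) < e" if "x \<in> U" for x
    proof -
      have "norm (mean (F x) - mean (F x0)) \<le> e/2"
        by (rule norm_mean_diff_le[OF Fx Fx]) (use U(3)[OF that] in \<open>simp add: dist_norm\<close>)
      then show ?thesis using e by (simp add: dist_norm)
    qed
    then show "\<forall>\<^sub>F x in at x0. dist (mean (F x)) (mean (F x0)) < e"
      unfolding eventually_at_topological using U(1,2) by blast
  qed
  then show ?thesis by (simp add: continuous_on_def)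
qed

text \<open>Replace the inner mean by one average that is good for all sections \<open>F x\<close> and also for the
  function \<open>y \<mapsto> mean (\<lambda>x. F x y)\<close>; averages may be exchanged with the mean.\<close>

lemma mean_fubini:
  fixes F :: "'a \<Rightarrow> 'a \<Rightarrow> 'b::euclidean_space"
  assumes F: "continuous_on UNIV (\<lambda>p. F (fst p) (snd p))"
  shows "mean (\<lambda>x. mean (F x)) = mean (\<lambda>y. mean (\<lambda>x. F x y))"
proof -
  let ?H = "\<lambda>y. mean (\<lambda>x. F x y)"
  have F': "continuous_on UNIV (\<lambda>p. F (snd p) (fst p))"
    by (rule continuous_swap[OF F])
  have Fy: "continuous_on UNIV (\<lambda>x. F x y)" for y
    by (rule continuous_section[OF F'])
  have H: "continuous_on UNIV ?H" by (rule continuous_mean_param[OF F'])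
  have I: "continuous_on UNIV (\<lambda>x. mean (F x))" by (rule continuous_mean_param[OF F])
  have "norm (mean (\<lambda>x. mean (F x)) - mean ?H) \<le> e" if "e > 0" for e
  proof -
    have e2: "e / 2 > 0" using that by simp
    obtain xs where xs: "xs \<noteq> []" "\<And>x z. norm (avg xs (F x) z - mean (F x)) \<le> e/2"
      by (rule uniform_mean_approximation[OF F e2]) (rule that)
    obtain ys where ys: "ys \<noteq> []" "\<And>z. norm (avg ys ?H z - mean ?H) \<le> e/2"
      by (rule has_meanD[OF has_mean_mean[OF H] e2]) (rule that)
    let ?zs = "pairwise_sums xs ys"
    have 1: "norm (avg ?zs (F x) 0 - mean (F x)) \<le> e/2" for x
      using pairwise_sums_close(1)[OF ys(1) xs(2)] .
    have 2: "norm (avg ?zs ?H 0 - mean ?H) \<le> e/2"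
      using pairwise_sums_close(2)[OF xs(1) ys(2)] .
    have "has_mean (\<lambda>x. avg ?zs (F x) 0) (avg ?zs ?H 0)"
      by (rule has_mean_avg) (rule has_mean_mean[OF Fy])
    from has_mean_add[OF this has_mean_bounded_linear[OF bounded_linear_minus[OF bounded_linear_ident] has_mean_mean[OF I]]]
    have "has_mean (\<lambda>x. avg ?zs (F x) 0 - mean (F x)) (avg ?zs ?H 0 - mean (\<lambda>x. mean (F x)))"
      by simp
    then have "norm (avg ?zs ?H 0 - mean (\<lambda>x. mean (F x))) \<le> e/2"
      using norm_has_mean_le[OF _ has_mean_const] 1 by blast
    then show ?thesis
      using 2 norm_triangle_ineq4[of "avg ?zs ?H 0 - mean ?H" "avg ?zs ?H 0 - mean (\<lambda>x. mean (F x))"]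
      by simp
  qed
  then have "norm (mean (\<lambda>x. mean (F x)) - mean ?H) \<le> 0" by (rule field_le_epsilon[of _ 0, simplified])
  then show ?thesis by simp
qed

end

section \<open>The inner product given by the mean\<close>

lemma cont_funsD: "f \<in> cont_funs \<Longrightarrow> continuous_on UNIV f"
  and cont_funsI: "continuous_on UNIV f \<Longrightarrow> f \<in> cont_funs"
  by (simp_all add: cont_funs_def)

lemma cont_funs_const: "(\<lambda>_. c) \<in> cont_funs"
  by (simp add: cont_funs_def)

lemma cont_funs_add: "f \<in> cont_funs \<Longrightarrow> g \<in> cont_funs \<Longrightarrow> (\<lambda>x. f x + g x) \<in> cont_funs"
  by (simp add: cont_funs_def continuous_on_add)

lemma cont_funs_diff: "f \<in> cont_funs \<Longrightarrow> g \<in> cont_funs \<Longrightarrow> (\<lambda>x. f x - g x) \<in> cont_funs"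
  by (simp add: cont_funs_def continuous_on_diff)

lemma cont_funs_mult: "f \<in> cont_funs \<Longrightarrow> g \<in> cont_funs \<Longrightarrow> (\<lambda>x. f x * g x) \<in> cont_funs"
  by (simp add: cont_funs_def continuous_on_mult)

lemma cont_funs_cnj: "f \<in> cont_funs \<Longrightarrow> (\<lambda>x. cnj (f x)) \<in> cont_funs"
  by (simp add: cont_funs_def continuous_on_cnj)

lemma cont_funs_sum: "(\<And>i. i \<in> I \<Longrightarrow> f i \<in> cont_funs) \<Longrightarrow> (\<lambda>x. \<Sum>i\<in>I. f i x) \<in> cont_funs"
  by (simp add: cont_funs_def continuous_on_sum)

lemma cont_funs_translate:
  fixes f :: "'a::topological_ab_group_add \<Rightarrow> complex"
  shows "f \<in> cont_funs \<Longrightarrow> (\<lambda>x. f (x + t)) \<in> cont_funs"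
  unfolding cont_funs_def mem_Collect_eq
  by (rule continuous_on_compose2[of UNIV f])
    (intro continuous_on_add continuous_on_id continuous_on_const subset_UNIV | assumption)+

definition l2_inner :: "('a::ab_group_add \<Rightarrow> complex) \<Rightarrow> ('a \<Rightarrow> complex) \<Rightarrow> complex" where
  "l2_inner f g = mean (\<lambda>x. f x * cnj (g x))"

definition l2_norm :: "('a::ab_group_add \<Rightarrow> complex) \<Rightarrow> real" where
  "l2_norm f = sqrt (mean (\<lambda>x. (norm (f x))\<^sup>2))"

context compact_ab_group
begin

lemma l2_inner_add_left:
  fixes f g h :: "'a \<Rightarrow> complex"
  assumes "f \<in> cont_funs" "g \<in> cont_funs" "h \<in> cont_funs"
  shows "l2_inner (\<lambda>x. f x + g x) h = l2_inner f h + l2_inner g h"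
  unfolding l2_inner_def distrib_right
  by (intro mean_add cont_funsD cont_funs_mult cont_funs_cnj assms)

lemma l2_inner_scale_left:
  fixes f h :: "'a \<Rightarrow> complex"
  assumes "f \<in> cont_funs" "h \<in> cont_funs"
  shows "l2_inner (\<lambda>x. c * f x) h = c * l2_inner f h"
proof -
  have "continuous_on UNIV (\<lambda>x. f x * cnj (h x))"
    by (intro cont_funsD cont_funs_mult cont_funs_cnj assms)
  from mean_bounded_linear[OF this bounded_linear_mult_right[of c]]
  show ?thesis by (simp add: l2_inner_def mult.assoc)
qed

lemma l2_inner_cnj:
  fixes f g :: "'a \<Rightarrow> complex"
  assumes "f \<in> cont_funs" "g \<in> cont_funs"
  shows "cnj (l2_inner f g) = l2_inner g f"
proof -
  have "continuous_on UNIV (\<lambda>x. f x * cnj (g x))"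
    by (intro cont_funsD cont_funs_mult cont_funs_cnj assms)
  from mean_bounded_linear[OF this bounded_linear_cnj]
  show ?thesis by (simp add: l2_inner_def mult.commute)
qed

lemma l2_inner_diff_left:
  fixes f g h :: "'a \<Rightarrow> complex"
  assumes "f \<in> cont_funs" "g \<in> cont_funs" "h \<in> cont_funs"
  shows "l2_inner (\<lambda>x. f x - g x) h = l2_inner f h - l2_inner g h"
  unfolding l2_inner_def left_diff_distrib
  by (intro mean_diff cont_funsD cont_funs_mult cont_funs_cnj assms)

lemma l2_inner_diff_right:
  fixes f g h :: "'a \<Rightarrow> complex"
  assumes "f \<in> cont_funs" "g \<in> cont_funs" "h \<in> cont_funs"
  shows "l2_inner h (\<lambda>x. f x - g x) = l2_inner h f - l2_inner h g"
  unfolding l2_inner_def complex_cnj_diff right_diff_distrib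
  by (intro mean_diff cont_funsD cont_funs_mult cont_funs_cnj assms)

lemma l2_inner_scale_right:
  fixes f h :: "'a \<Rightarrow> complex"
  assumes "f \<in> cont_funs" "h \<in> cont_funs"
  shows "l2_inner h (\<lambda>x. c * f x) = cnj c * l2_inner h f"
  using l2_inner_scale_left[OF assms, of c] l2_inner_cnj[OF assms]
    l2_inner_cnj[OF cont_funs_mult[OF cont_funs_const assms(1)] assms(2), of c]
  by (metis complex_cnj_mult)

lemma l2_inner_sum_left:
  fixes f :: "'i \<Rightarrow> 'a \<Rightarrow> complex"
  assumes "\<And>i. i \<in> I \<Longrightarrow> f i \<in> cont_funs" "h \<in> cont_funs"
  shows "l2_inner (\<lambda>x. \<Sum>i\<in>I. f i x) h = (\<Sum>i\<in>I. l2_inner (f i) h)"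
proof -
  have "has_mean (\<lambda>x. \<Sum>i\<in>I. f i x * cnj (h x)) (\<Sum>i\<in>I. l2_inner (f i) h)"
    unfolding l2_inner_def
    by (intro has_mean_sum has_mean_mean cont_funsD cont_funs_mult cont_funs_cnj assms)
  then show ?thesis using mean_eqI by (simp add: l2_inner_def sum_distrib_right)
qed

lemma cont_norm_sq:
  fixes f :: "'a \<Rightarrow> complex"
  assumes "f \<in> cont_funs"
  shows "continuous_on UNIV (\<lambda>x. (norm (f x))\<^sup>2)"
  by (intro continuous_on_power continuous_on_norm cont_funsD assms)

lemma l2_norm_sq:
  fixes f :: "'a \<Rightarrow> complex"
  assumes "f \<in> cont_funs"
  shows "(l2_norm f)\<^sup>2 = mean (\<lambda>x. (norm (f x))\<^sup>2)" "l2_norm f \<ge> 0"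
proof -
  have "mean (\<lambda>x::'a. 0::real) \<le> mean (\<lambda>x. (norm (f x))\<^sup>2)"
    by (rule mean_mono[OF continuous_on_const cont_norm_sq[OF assms]]) simp
  then show "(l2_norm f)\<^sup>2 = mean (\<lambda>x. (norm (f x))\<^sup>2)" "l2_norm f \<ge> 0" by (simp_all add: l2_norm_def)
qed

lemma l2_inner_self:
  fixes f :: "'a \<Rightarrow> complex"
  assumes "f \<in> cont_funs"
  shows "l2_inner f f = complex_of_real ((l2_norm f)\<^sup>2)"
  unfolding l2_inner_def l2_norm_sq(1)[OF assms] complex_norm_square[symmetric]
  by (rule mean_bounded_linear[OF cont_norm_sq[OF assms] bounded_linear_of_real])

text \<open>Continuous functions are not identified almost everywhere, so definiteness yields equality.\<close>

lemma l2_norm_zeroD: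
  fixes f :: "'a \<Rightarrow> complex"
  assumes f: "f \<in> cont_funs" and 0: "l2_norm f = 0"
  shows "f = (\<lambda>_. 0)"
proof (rule ccontr)
  assume "f \<noteq> (\<lambda>_. 0)"
  then obtain x where "f x \<noteq> 0" by (auto simp: fun_eq_iff)
  then have "(norm (f x))\<^sup>2 > 0" by simp
  then have "mean (\<lambda>x. (norm (f x))\<^sup>2) > 0" by (intro mean_pos[OF cont_norm_sq[OF f]]) simp_all
  then show False using l2_norm_sq(1)[OF f] 0 by simp
qed

lemma l2_norm_zero [simp]: "l2_norm (\<lambda>_::'a. 0) = 0"
  by (simp add: l2_norm_def)

text \<open>The Cauchy-Schwarz inequality for absolute values, by integrating the weighted inequality of
  arithmetic and geometric means.\<close>

lemma mean_norm_mult_le: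
  fixes f g :: "'a \<Rightarrow> complex"
  assumes f: "f \<in> cont_funs" and g: "g \<in> cont_funs"
  shows "mean (\<lambda>x. norm (f x) * norm (g x)) \<le> l2_norm f * l2_norm g"
proof (cases "l2_norm f = 0 \<or> l2_norm g = 0")
  case True
  then show ?thesis using l2_norm_zeroD[OF f] l2_norm_zeroD[OF g] by auto
next
  case False
  then have a: "l2_norm f > 0" and b: "l2_norm g > 0" using l2_norm_sq(2)[OF f] l2_norm_sq(2)[OF g] by auto
  define s where "s = l2_norm g / (2 * l2_norm f)"
  define t where "t = l2_norm f / (2 * l2_norm g)"
  have s: "s > 0" "t > 0" "4 * s * t = 1" using a b by (simp_all add: s_def t_def)
  have amgm: "p * q \<le> s * p\<^sup>2 + t * q\<^sup>2" for p q :: real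
  proof -
    have "0 \<le> (2 * s * p - q)\<^sup>2" by simp
    also have "\<dots> = 4 * s * (s * p\<^sup>2 + t * q\<^sup>2 - p * q)"
    proof -
      have "(2 * s * p - q)\<^sup>2 = 4 * s * (s * p\<^sup>2) - 4 * s * (p * q) + 1 * q\<^sup>2"
        by (simp add: power2_eq_square algebra_simps)
      then show ?thesis unfolding s(3)[symmetric] by (simp add: algebra_simps)
    qed
    finally show ?thesis using s(1) by (simp add: zero_le_mult_iff)
  qed
  have cf: "continuous_on UNIV (\<lambda>x. s * (norm (f x))\<^sup>2)"
    and cg: "continuous_on UNIV (\<lambda>x. t * (norm (g x))\<^sup>2)"
    by (intro continuous_on_mult continuous_on_const cont_norm_sq f g)+
  have "mean (\<lambda>x. norm (f x) * norm (g x)) \<le> mean (\<lambda>x. s * (norm (f x))\<^sup>2 + t * (norm (g x))\<^sup>2)"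
    by (rule mean_mono[OF _ continuous_on_add[OF cf cg] amgm])
      (intro continuous_on_mult continuous_on_norm cont_funsD f g)
  also have "\<dots> = s * (l2_norm f)\<^sup>2 + t * (l2_norm g)\<^sup>2"
    unfolding mean_add[OF cf cg] l2_norm_sq(1)[OF f] l2_norm_sq(1)[OF g]
    using mean_bounded_linear[OF cont_norm_sq[OF f] bounded_linear_mult_right[of s]]
      mean_bounded_linear[OF cont_norm_sq[OF g] bounded_linear_mult_right[of t]]
    by simp
  also have "\<dots> = l2_norm f * l2_norm g"
    using a b by (simp add: s_def t_def power2_eq_square)
  finally show ?thesis .
qed

lemma norm_l2_inner_le:
  fixes f g :: "'a \<Rightarrow> complex"
  assumes f: "f \<in> cont_funs" and g: "g \<in> cont_funs"
  shows "norm (l2_inner f g) \<le> l2_norm f * l2_norm g"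
proof -
  have "norm (l2_inner f g) \<le> mean (\<lambda>x. norm (f x) * norm (g x))"
    unfolding l2_inner_def
    by (rule norm_mean_le)
      ((intro continuous_on_mult continuous_on_norm continuous_on_cnj cont_funsD f g)+, simp add: norm_mult)
  with mean_norm_mult_le[OF f g] show ?thesis by linarith
qed

lemma l2_norm_le_sup:
  fixes f :: "'a \<Rightarrow> complex"
  assumes f: "f \<in> cont_funs" and le: "\<And>x. norm (f x) \<le> C"
  shows "l2_norm f \<le> C"
proof -
  have C: "C \<ge> 0" using le[of 0] norm_ge_zero[of "f 0"] by linarith
  have "mean (\<lambda>x. (norm (f x))\<^sup>2) \<le> mean (\<lambda>x::'a. C\<^sup>2)"
    by (rule mean_mono[OF cont_norm_sq[OF f] continuous_on_const]) (simp add: le power_mono)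
  then show ?thesis unfolding l2_norm_def using C by (simp add: real_le_lsqrt)
qed

lemma mean_norm_le_l2_norm:
  fixes f :: "'a \<Rightarrow> complex"
  assumes f: "f \<in> cont_funs"
  shows "mean (\<lambda>x. norm (f x)) \<le> l2_norm f"
proof -
  have "l2_norm (\<lambda>x::'a. 1) \<le> 1" by (rule l2_norm_le_sup[OF cont_funs_const]) simp
  then have "l2_norm f * l2_norm (\<lambda>x::'a. 1) \<le> l2_norm f"
    using l2_norm_sq(2)[OF f] by (rule mult_left_le)
  then show ?thesis using mean_norm_mult_le[OF f cont_funs_const[of 1]] by simp
qed

lemma l2_norm_diff_sq:
  fixes f g :: "'a \<Rightarrow> complex"
  assumes f: "f \<in> cont_funs" and g: "g \<in> cont_funs"
  shows "(l2_norm (\<lambda>x. f x - g x))\<^sup>2 = (l2_norm f)\<^sup>2 - 2 * Re (l2_inner f g) + (l2_norm g)\<^sup>2"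
proof -
  have d: "(\<lambda>x. f x - g x) \<in> cont_funs" by (rule cont_funs_diff[OF f g])
  have "complex_of_real ((l2_norm (\<lambda>x. f x - g x))\<^sup>2) = l2_inner f f - l2_inner g f - (l2_inner f g - l2_inner g g)"
    unfolding l2_inner_self[OF d, symmetric] l2_inner_diff_right[OF f g d] l2_inner_diff_left[OF f g f] l2_inner_diff_left[OF f g g] ..
  also have "\<dots> = complex_of_real ((l2_norm f)\<^sup>2) - (l2_inner f g + cnj (l2_inner f g)) + complex_of_real ((l2_norm g)\<^sup>2)"
    by (simp add: l2_inner_self f g l2_inner_cnj)
  also have "\<dots> = complex_of_real ((l2_norm f)\<^sup>2 - 2 * Re (l2_inner f g) + (l2_norm g)\<^sup>2)"
    by (simp add: complex_add_cnj)
  finally show ?thesis unfolding of_real_eq_iff .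
qed

lemma l2_norm_diff_triangle:
  fixes f g :: "'a \<Rightarrow> complex"
  assumes f: "f \<in> cont_funs" and g: "g \<in> cont_funs"
  shows "l2_norm (\<lambda>x. f x - g x) \<le> l2_norm f + l2_norm g"
proof (rule power2_le_imp_le)
  have "- Re (l2_inner f g) \<le> l2_norm f * l2_norm g"
    using norm_l2_inner_le[OF f g] abs_Re_le_cmod[of "l2_inner f g"] by linarith
  then show "(l2_norm (\<lambda>x. f x - g x))\<^sup>2 \<le> (l2_norm f + l2_norm g)\<^sup>2"
    unfolding l2_norm_diff_sq[OF f g] by (simp add: power2_sum)
  show "0 \<le> l2_norm f + l2_norm g" using l2_norm_sq(2)[OF f] l2_norm_sq(2)[OF g] by simp
qed

lemma l2_norm_scale:
  fixes f :: "'a \<Rightarrow> complex"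
  assumes f: "f \<in> cont_funs"
  shows "l2_norm (\<lambda>x. c * f x) = norm c * l2_norm f"
proof (rule power2_eq_imp_eq)
  have c: "(\<lambda>x. c * f x) \<in> cont_funs" by (rule cont_funs_mult[OF cont_funs_const f])
  show "0 \<le> l2_norm (\<lambda>x. c * f x)" by (rule l2_norm_sq(2)[OF c])
  show "0 \<le> norm c * l2_norm f" using l2_norm_sq(2)[OF f] by simp
  show "(l2_norm (\<lambda>x. c * f x))\<^sup>2 = (norm c * l2_norm f)\<^sup>2"
    unfolding l2_norm_sq(1)[OF c] norm_mult power_mult_distrib l2_norm_sq(1)[OF f]
    using mean_bounded_linear[OF cont_norm_sq[OF f] bounded_linear_mult_right[of "(norm c)\<^sup>2"]]
    by simp
qed

end

section \<open>Orthogonal projection onto the span of a finite orthonormal set\<close>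

definition orthonormal :: "('a::topological_ab_group_add \<Rightarrow> complex) set \<Rightarrow> bool" where
  "orthonormal B \<longleftrightarrow> finite B \<and> B \<subseteq> cont_funs \<and> (\<forall>b\<in>B. \<forall>c\<in>B. l2_inner b c = (if b = c then 1 else 0))"

definition proj :: "('a::ab_group_add \<Rightarrow> complex) set \<Rightarrow> ('a \<Rightarrow> complex) \<Rightarrow> 'a \<Rightarrow> complex" where
  "proj B f x = (\<Sum>b\<in>B. l2_inner f b * b x)"

lemma sum_fun_apply: "(\<Sum>i\<in>I. f i) x = (\<Sum>i\<in>I. f i x)"
  by (induction I rule: infinite_finite_induct) simp_all

lemma span_finite_pointwise:
  assumes "finite B"
  shows "f \<in> cfun.span B \<longleftrightarrow> (\<exists>u. f = (\<lambda>x. \<Sum>b\<in>B. u b * b x))"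
  unfolding cfun.span_finite[OF assms] by (auto simp: fun_eq_iff sum_fun_apply)

lemma proj_in_span: "finite B \<Longrightarrow> proj B f \<in> cfun.span B"
  using span_finite_pointwise[of B "proj B f"] by (auto simp: proj_def fun_eq_iff)

context compact_ab_group
begin

context
  fixes B :: "('a \<Rightarrow> complex) set" and f :: "'a \<Rightarrow> complex"
  assumes B: "orthonormal B" and f: "f \<in> cont_funs"
begin

lemma proj_cont: "proj B f \<in> cont_funs"
  using B unfolding proj_def[abs_def] orthonormal_def
  by (intro cont_funs_sum cont_funs_mult cont_funs_const) auto

lemma residual_cont: "(\<lambda>x. f x - proj B f x) \<in> cont_funs"
  by (rule cont_funs_diff[OF f proj_cont])

lemma l2_inner_proj_left:
  assumes h: "h \<in> cont_funs"
  shows "l2_inner (proj B f) h = (\<Sum>b\<in>B. l2_inner f b * l2_inner b h)"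
proof -
  have c: "b \<in> cont_funs" if "b \<in> B" for b using B that unfolding orthonormal_def by blast
  have "l2_inner (proj B f) h = (\<Sum>b\<in>B. l2_inner (\<lambda>x. l2_inner f b * b x) h)"
    unfolding proj_def[abs_def] by (rule l2_inner_sum_left[OF cont_funs_mult[OF cont_funs_const c] h])
  also have "\<dots> = (\<Sum>b\<in>B. l2_inner f b * l2_inner b h)"
    by (rule sum.cong[OF refl]) (rule l2_inner_scale_left[OF c h])
  finally show ?thesis .
qed

lemma l2_inner_residual:
  assumes b: "b \<in> B"
  shows "l2_inner (\<lambda>x. f x - proj B f x) b = 0"
proof -
  have c: "b \<in> cont_funs" using B b unfolding orthonormal_def by blast
  have "l2_inner (proj B f) b = (\<Sum>b'\<in>B. if b' = b then l2_inner f b' else 0)"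
    unfolding l2_inner_proj_left[OF c] using B b unfolding orthonormal_def by (intro sum.cong) auto
  also have "\<dots> = l2_inner f b" using B b unfolding orthonormal_def by simp
  finally show ?thesis unfolding l2_inner_diff_left[OF f proj_cont c] by simp
qed

lemma l2_inner_span_residual:
  assumes s: "s \<in> cfun.span B"
  shows "s \<in> cont_funs" "l2_inner s (\<lambda>x. f x - proj B f x) = 0"
proof -
  have c: "b \<in> cont_funs" if "b \<in> B" for b using B that unfolding orthonormal_def by blast
  obtain u where u: "s = (\<lambda>x. \<Sum>b\<in>B. u b * b x)"
    using s B span_finite_pointwise unfolding orthonormal_def by blast
  show "s \<in> cont_funs" unfolding u by (intro cont_funs_sum cont_funs_mult cont_funs_const c)
  have 0: "l2_inner b (\<lambda>x. f x - proj B f x) = 0" if "b \<in> B" for b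
    using l2_inner_cnj[OF residual_cont c[OF that]] l2_inner_residual[OF that] by simp
  show "l2_inner s (\<lambda>x. f x - proj B f x) = 0"
    unfolding u
    by (subst l2_inner_sum_left[OF cont_funs_mult[OF cont_funs_const c] residual_cont])
      (simp_all add: l2_inner_scale_left[OF c residual_cont] 0)
qed

lemma l2_norm_residual_sq:
  "(l2_norm (\<lambda>x. f x - proj B f x))\<^sup>2 = (l2_norm f)\<^sup>2 - (\<Sum>b\<in>B. (norm (l2_inner f b))\<^sup>2)"
proof -
  let ?r = "\<lambda>x. f x - proj B f x"
  have c: "b \<in> cont_funs" if "b \<in> B" for b using B that unfolding orthonormal_def by blast
  have "l2_inner (proj B f) ?r = 0"
    using B by (intro l2_inner_span_residual(2) proj_in_span) (simp add: orthonormal_def)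
  then have "l2_inner ?r (proj B f) = 0"
    using l2_inner_cnj[OF proj_cont residual_cont] by simp
  then have "l2_inner ?r ?r = l2_inner ?r f"
    using l2_inner_diff_right[OF f proj_cont residual_cont] by simp
  also have "\<dots> = l2_inner f f - (\<Sum>b\<in>B. l2_inner f b * l2_inner b f)"
    unfolding l2_inner_diff_left[OF f proj_cont f] l2_inner_proj_left[OF f] ..
  also have "(\<Sum>b\<in>B. l2_inner f b * l2_inner b f) = (\<Sum>b\<in>B. complex_of_real ((norm (l2_inner f b))\<^sup>2))"
    by (rule sum.cong[OF refl]) (simp only: complex_norm_square l2_inner_cnj[OF f c])
  finally have "complex_of_real ((l2_norm ?r)\<^sup>2) = complex_of_real ((l2_norm f)\<^sup>2 - (\<Sum>b\<in>B. (norm (l2_inner f b))\<^sup>2))"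
    by (simp add: l2_inner_self[OF residual_cont] l2_inner_self[OF f])
  then show ?thesis unfolding of_real_eq_iff .
qed

lemma bessel: "(\<Sum>b\<in>B. (norm (l2_inner f b))\<^sup>2) \<le> (l2_norm f)\<^sup>2"
  using l2_norm_residual_sq zero_le_power2[of "l2_norm (\<lambda>x. f x - proj B f x)"] by linarith

lemma l2_norm_residual_le: "l2_norm (\<lambda>x. f x - proj B f x) \<le> l2_norm f"
proof (rule power2_le_imp_le[OF _ l2_norm_sq(2)[OF f]])
  have "0 \<le> (\<Sum>b\<in>B. (norm (l2_inner f b))\<^sup>2)" by (rule sum_nonneg) simp
  then show "(l2_norm (\<lambda>x. f x - proj B f x))\<^sup>2 \<le> (l2_norm f)\<^sup>2" unfolding l2_norm_residual_sq by linarith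
qed

text \<open>The projection is the best approximation in the span; this is what makes the span closed.\<close>

lemma l2_norm_residual_le_dist:
  assumes s: "s \<in> cfun.span B"
  shows "l2_norm (\<lambda>x. f x - proj B f x) \<le> l2_norm (\<lambda>x. f x - s x)"
proof (cases "l2_norm (\<lambda>x. f x - proj B f x) = 0")
  case True
  then show ?thesis using l2_norm_sq(2)[OF cont_funs_diff[OF f l2_inner_span_residual(1)[OF s]]] by simp
next
  case False
  let ?r = "\<lambda>x. f x - proj B f x" and ?d = "\<lambda>x. f x - s x"
  have sc: "s \<in> cont_funs" by (rule l2_inner_span_residual(1)[OF s])
  have d: "?d \<in> cont_funs" by (rule cont_funs_diff[OF f sc])
  have "l2_inner (proj B f) ?r = 0"
    using B by (intro l2_inner_span_residual(2) proj_in_span) (simp add: orthonormal_def)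
  then have "l2_inner ?r ?r = l2_inner ?d ?r"
    using l2_inner_span_residual(2)[OF s] l2_inner_diff_left[OF f proj_cont residual_cont]
      l2_inner_diff_left[OF f sc residual_cont] by simp
  moreover have "norm (l2_inner ?r ?r) = l2_norm ?r * l2_norm ?r"
    unfolding l2_inner_self[OF residual_cont] norm_of_real by (simp add: power2_eq_square)
  ultimately have "l2_norm ?r * l2_norm ?r \<le> l2_norm ?d * l2_norm ?r"
    using norm_l2_inner_le[OF d residual_cont] by simp
  then show ?thesis using False l2_norm_sq(2)[OF residual_cont] by (simp add: mult_le_cancel_right)
qed

end

end

section \<open>Compactness of equicontinuous sequences\<close>

context compact_ab_group
begin

text \<open>A member of the family is determined up to \<open>e\<close> by its values, rounded to a grid of mesh \<open>e / 8\<close>,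
  at finitely many points whose neighbourhoods of equicontinuity cover the group. There are
  only finitely many tables of rounded values.\<close>

lemma equicontinuous_finite_net:
  fixes h :: "'i \<Rightarrow> 'a \<Rightarrow> complex"
  assumes bd: "\<And>i x. norm (h i x) \<le> M"
    and eq: "\<And>e. e > 0 \<Longrightarrow> \<exists>U. open U \<and> 0 \<in> U \<and> (\<forall>i. \<forall>u\<in>U. \<forall>x. norm (h i (x + u) - h i x) \<le> e)"
    and e: "e > 0"
  shows "\<exists>J. finite J \<and> (\<forall>i. \<exists>j\<in>J. \<forall>x. norm (h i x - h j x) < e)"
proof -
  have "e / 4 > 0" using e by simp
  from eq[OF this] obtain U where U: "open U" "0 \<in> U"
      "\<forall>i. \<forall>u\<in>U. \<forall>x. norm (h i (x + u) - h i x) \<le> e / 4" by blast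
  obtain ys :: "'a list" where ys: "\<And>x. \<exists>y\<in>set ys. x + y \<in> U"
    by (rule finite_translates_cover[OF U(1,2)]) (rule that)
  define X where "X = uminus ` set ys"
  define d where "d = e / 8"
  have d: "d > 0" using e by (simp add: d_def)
  define code where "code i = restrict (\<lambda>p. (\<lfloor>Re (h i p) / d\<rfloor>, \<lfloor>Im (h i p) / d\<rfloor>)) X" for i
  have "code i \<in> X \<rightarrow>\<^sub>E {\<lfloor>- (M / d)\<rfloor>..\<lfloor>M / d\<rfloor>} \<times> {\<lfloor>- (M / d)\<rfloor>..\<lfloor>M / d\<rfloor>}" for i
  proof -
    have *: "\<lfloor>- (M / d)\<rfloor> \<le> \<lfloor>r / d\<rfloor>" "\<lfloor>r / d\<rfloor> \<le> \<lfloor>M / d\<rfloor>" if "\<bar>r\<bar> \<le> M" for r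
      unfolding minus_divide_left by (intro floor_mono divide_right_mono; use that d in linarith)+
    have "\<bar>Re (h i p)\<bar> \<le> M" "\<bar>Im (h i p)\<bar> \<le> M" for p
      using abs_Re_le_cmod[of "h i p"] abs_Im_le_cmod[of "h i p"] bd[of i p] by linarith+
    then show ?thesis unfolding code_def by (intro restrict_PiE_iff[THEN iffD2] ballI) (simp add: *)
  qed
  then have "code ` UNIV \<subseteq> X \<rightarrow>\<^sub>E {\<lfloor>- (M / d)\<rfloor>..\<lfloor>M / d\<rfloor>} \<times> {\<lfloor>- (M / d)\<rfloor>..\<lfloor>M / d\<rfloor>}" by blast
  then have "finite (code ` UNIV)"
    by (rule finite_subset) (intro finite_PiE finite_SigmaI finite_atLeastAtMost_int, simp add: X_def)
  from finite_subset_image[OF this subset_refl]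
  obtain J where J: "finite J" "code ` UNIV = code ` J" by blast
  have "\<exists>j\<in>J. \<forall>x. norm (h i x - h j x) < e" for i
  proof -
    have "code i \<in> code ` J" using J(2) by blast
    then obtain j where j: "j \<in> J" "code i = code j" by blast
    have "norm (h i x - h j x) < e" for x
    proof -
      obtain y where y: "y \<in> set ys" "x + y \<in> U" using ys by blast
      define p where "p = - y"
      have p: "p \<in> X" "x = p + (x + y)" using y(1) by (simp_all add: X_def p_def)
      have fl: "\<bar>a - b\<bar> \<le> d" if "\<lfloor>a / d\<rfloor> = \<lfloor>b / d\<rfloor>" for a b :: real
      proof -
        have "\<bar>a / d - b / d\<bar> \<le> 1" using that by linarith
        then have "\<bar>(a - b) / d\<bar> \<le> 1" by (simp add: diff_divide_distrib)
        then show ?thesis using d by (simp add: abs_divide)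
      qed
      have "code i p = code j p" using j(2) by simp
      then have "\<lfloor>Re (h i p) / d\<rfloor> = \<lfloor>Re (h j p) / d\<rfloor>" "\<lfloor>Im (h i p) / d\<rfloor> = \<lfloor>Im (h j p) / d\<rfloor>"
        using p(1) by (simp_all add: code_def)
      from fl[OF this(1)] fl[OF this(2)] have "norm (h i p - h j p) \<le> d + d"
        using cmod_le[of "h i p - h j p"] by simp
      moreover have "norm (h l x - h l p) \<le> e / 4" for l
        using U(3) y(2) p(2) by metis
      from this[of i] this[of j]
      have "norm (h i x - h i p) \<le> e / 4" "norm (h j x - h j p) \<le> e / 4" .
      moreover have "norm (h i x - h j x) \<le> norm (h i x - h i p) + norm (h i p - h j p) + norm (h j x - h j p)"
        using norm_triangle_ineq[of "h i x - h i p" "h i p - h j x"]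
          norm_triangle_ineq4[of "h i p - h j p" "h j x - h j p"] by simp
      ultimately show ?thesis using e unfolding d_def by linarith
    qed
    then show ?thesis using j(1) by blast
  qed
  then show ?thesis using J(1) by blast
qed

text \<open>The finite nets say that the sequence is totally bounded in the supremum metric, so it has a
  uniformly Cauchy subsequence.\<close>

lemma arzela_ascoli_sequence:
  fixes h :: "nat \<Rightarrow> 'a \<Rightarrow> complex"
  assumes cont: "\<And>n. h n \<in> cont_funs" and bd: "\<And>n x. norm (h n x) \<le> M"
    and eq: "\<And>e. e > 0 \<Longrightarrow> \<exists>U. open U \<and> 0 \<in> U \<and> (\<forall>n. \<forall>u\<in>U. \<forall>x. norm (h n (x + u) - h n x) \<le> e)"
  obtains g r where "strict_mono (r :: nat \<Rightarrow> nat)" "g \<in> cont_funs"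
    "\<And>e. e > 0 \<Longrightarrow> \<exists>N. \<forall>n\<ge>N. \<forall>x. norm (h (r n) x - g x) \<le> e"
proof -
  define b where "b n = Bcontfun (h n)" for n
  have ap: "apply_bcontfun (b n) = h n" for n
    unfolding b_def by (rule Bcontfun_inverse[OF bcontfun_normI[OF cont_funsD[OF cont] bd]])
  have dist: "dist (b n) (b m) \<le> e" if "\<And>x. norm (h n x - h m x) \<le> e" for n m e
    by (rule dist_bound) (simp add: ap dist_norm that)
  have "Met_TC.mtotally_bounded (range b)"
    unfolding Met_TC.mtotally_bounded_def mball_eq_ball
  proof (intro allI impI)
    fix e :: real assume e: "e > 0"
    then have "e / 2 > 0" by simp
    from equicontinuous_finite_net[of h M "e/2", OF bd eq this]
    obtain J where J: "finite J" "\<forall>i. \<exists>j\<in>J. \<forall>x. norm (h i x - h j x) < e / 2" by blast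
    have "range b \<subseteq> (\<Union>c\<in>b ` J. ball c e)"
    proof (rule image_subsetI)
      fix n
      obtain j where j: "j \<in> J" "\<forall>x. norm (h n x - h j x) < e / 2" using J(2) by blast
      have "dist (b n) (b j) \<le> e / 2" by (rule dist) (use j(2) in \<open>simp add: less_imp_le\<close>)
      then have "b n \<in> ball (b j) e" using e by (simp add: dist_commute)
      then show "b n \<in> (\<Union>c\<in>b ` J. ball c e)" using j(1) by blast
    qed
    then show "\<exists>K. finite K \<and> K \<subseteq> range b \<and> range b \<subseteq> (\<Union>c\<in>K. ball c e)"
      using J(1) by (intro exI[of _ "b ` J"]) (simp add: image_mono)
  qed
  then obtain r :: "nat \<Rightarrow> nat" where r: "strict_mono r" "Cauchy (b \<circ> r)"
    unfolding Met_TC.mtotally_bounded_sequentially MCauchy_iff_Cauchy by blast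
  have "uniformly_Cauchy_on UNIV (\<lambda>n. h (r n))"
    unfolding uniformly_Cauchy_on_def
  proof (intro allI impI)
    fix e :: real assume "e > 0"
    then obtain N where N: "\<forall>m\<ge>N. \<forall>n\<ge>N. dist ((b \<circ> r) m) ((b \<circ> r) n) < e"
      using r(2) unfolding Cauchy_def by blast
    have "dist (h (r m) x) (h (r n) x) < e" if "m \<ge> N" "n \<ge> N" for m n x
    proof -
      have "dist (b (r m)) (b (r n)) < e" using N that by simp
      then have "dist (apply_bcontfun (b (r m)) x) (apply_bcontfun (b (r n)) x) < e"
        by (rule dist_fun_lt_imp_dist_val_lt)
      then show ?thesis by (simp add: ap)
    qed
    then show "\<exists>N. \<forall>x\<in>UNIV. \<forall>m\<ge>N. \<forall>n\<ge>N. dist (h (r m) x) (h (r n) x) < e" by blast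
  qed
  from Cauchy_uniformly_convergent[OF this]
  obtain g where g: "uniform_limit UNIV (\<lambda>n. h (r n)) g sequentially"
    unfolding uniformly_convergent_on_def by blast
  show ?thesis
  proof (rule that[OF r(1)])
    show "g \<in> cont_funs"
      by (rule cont_funsI[OF uniform_limit_theorem[OF _ g]]) (simp_all add: cont_funsD[OF cont])
    fix e :: real assume "e > 0"
    then show "\<exists>N. \<forall>n\<ge>N. \<forall>x. norm (h (r n) x - g x) \<le> e"
      using g unfolding uniform_limit_sequentially_iff dist_norm by (meson UNIV_I less_imp_le)
  qed
qed

end

section \<open>Convolution with an even kernel\<close>

locale even_kernel = compact_ab_group G for G :: "'a::topological_ab_group_add itself" +
  fixes k :: "'a \<Rightarrow> real"
  assumes k_cont: "continuous_on UNIV k" and k_even: "k (- x) = k x"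
begin

text \<open>Since \<open>k\<close> is even, this is the convolution of \<open>k\<close> and \<open>f\<close>; in the form with \<open>x + y\<close> it is
  visibly a limit of linear combinations of translates of \<open>f\<close>.\<close>

definition conv :: "('a \<Rightarrow> complex) \<Rightarrow> 'a \<Rightarrow> complex" where
  "conv f x = mean (\<lambda>y. complex_of_real (k y) * f (x + y))"

lemma integrand_cont:
  assumes f: "f \<in> cont_funs"
  shows "continuous_on UNIV (\<lambda>p. complex_of_real (k (snd p)) * f (fst p + snd p))"
proof -
  have 1: "continuous_on UNIV (\<lambda>p::'a \<times> 'a. k (snd p))"
    by (rule continuous_on_compose2[OF k_cont continuous_on_snd[OF continuous_on_id] subset_UNIV])
  have 2: "continuous_on UNIV (\<lambda>p::'a \<times> 'a. f (fst p + snd p))"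
    by (rule continuous_on_compose2[OF cont_funsD[OF f] _ subset_UNIV])
      (intro continuous_on_add continuous_on_fst continuous_on_snd continuous_on_id)
  show ?thesis by (rule continuous_on_mult[OF continuous_on_of_real[OF 1] 2])
qed

lemma section_cont: "f \<in> cont_funs \<Longrightarrow> (\<lambda>y. complex_of_real (k y) * f (x + y)) \<in> cont_funs"
  by (rule cont_funsI)
    (rule continuous_section[where F = "\<lambda>x y. complex_of_real (k y) * f (x + y)", OF integrand_cont])

lemma conv_cont:
  assumes "f \<in> cont_funs"
  shows "conv f \<in> cont_funs"
  using continuous_mean_param[where F = "\<lambda>x y. complex_of_real (k y) * f (x + y)", OF integrand_cont[OF assms]]
  unfolding conv_def[abs_def] by (rule cont_funsI)

lemma conv_diff:
  assumes "f \<in> cont_funs" "g \<in> cont_funs"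
  shows "conv (\<lambda>x. f x - g x) = (\<lambda>x. conv f x - conv g x)"
  unfolding conv_def[abs_def] right_diff_distrib
  by (rule ext) (intro mean_diff cont_funsD section_cont assms)

lemma conv_scale:
  assumes "f \<in> cont_funs"
  shows "conv (\<lambda>x. c * f x) = (\<lambda>x. c * conv f x)"
proof
  fix x
  note c = cont_funsD[OF section_cont[OF assms, of x]]
  have "mean (\<lambda>y. c * (complex_of_real (k y) * f (x + y))) = c * mean (\<lambda>y. complex_of_real (k y) * f (x + y))"
    by (rule mean_bounded_linear[OF c bounded_linear_mult_right])
  then show "conv (\<lambda>x. c * f x) x = c * conv f x" by (simp add: conv_def mult.left_commute)
qed

lemma conv_sum:
  assumes "\<And>i. i \<in> I \<Longrightarrow> f i \<in> cont_funs"
  shows "conv (\<lambda>x. \<Sum>i\<in>I. f i x) = (\<lambda>x. \<Sum>i\<in>I. conv (f i) x)"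
proof
  fix x
  have "has_mean (\<lambda>y. \<Sum>i\<in>I. complex_of_real (k y) * f i (x + y)) (\<Sum>i\<in>I. conv (f i) x)"
    unfolding conv_def by (intro has_mean_sum has_mean_mean cont_funsD section_cont assms)
  then show "conv (\<lambda>x. \<Sum>i\<in>I. f i x) x = (\<Sum>i\<in>I. conv (f i) x)"
    unfolding conv_def[of "\<lambda>x. \<Sum>i\<in>I. f i x"] sum_distrib_left by (rule mean_eqI)
qed

lemma conv_translate: "conv (\<lambda>x. f (x + t)) = (\<lambda>x. conv f (x + t))"
  by (simp add: conv_def[abs_def] ac_simps)

lemma k_shift_cont: "continuous_on UNIV (\<lambda>y. k (y + t))"
  by (rule continuous_on_compose2[OF k_cont _ subset_UNIV])
    (intro continuous_on_add continuous_on_id continuous_on_const)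

lemma conv_shifted:
  assumes "f \<in> cont_funs"
  shows "conv f x = mean (\<lambda>y. complex_of_real (k (y - x)) * f y)"
proof -
  have "continuous_on UNIV (\<lambda>y. complex_of_real (k (y + - x)) * f y)"
    by (intro continuous_on_mult continuous_on_of_real k_shift_cont cont_funsD assms)
  from mean_translate[OF this, of x] show ?thesis
    by (simp add: conv_def add.commute)
qed

text \<open>After Fubini the translation \<open>x \<mapsto> x - y\<close> moves the shift from \<open>f\<close> to \<open>g\<close>, and the reflection
  \<open>y \<mapsto> -y\<close> leaves the even kernel unchanged.\<close>

lemma conv_self_adjoint:
  assumes f: "f \<in> cont_funs" and g: "g \<in> cont_funs"
  shows "l2_inner (conv f) g = l2_inner f (conv g)"
proof -
  let ?F = "\<lambda>x y. complex_of_real (k y) * f (x + y) * cnj (g x)"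
  let ?H = "\<lambda>x y. complex_of_real (k y) * f x * cnj (g (x + y))"
  have cF: "continuous_on UNIV (\<lambda>p. ?F (fst p) (snd p))"
    by (rule continuous_on_mult[OF integrand_cont[OF f]])
      (intro continuous_on_cnj continuous_on_compose2[OF cont_funsD[OF g] continuous_on_fst[OF continuous_on_id] subset_UNIV])
  have cH: "continuous_on UNIV (\<lambda>p. ?H (fst p) (snd p))"
  proof -
    have "continuous_on UNIV (\<lambda>p. f (fst p) * cnj (complex_of_real (k (snd p)) * g (fst p + snd p)))"
      by (intro continuous_on_mult continuous_on_cnj integrand_cont g
          continuous_on_compose2[OF cont_funsD[OF f] continuous_on_fst[OF continuous_on_id] subset_UNIV])
    then show ?thesis by (simp add: mult_ac)
  qed
  have "l2_inner (conv f) g = mean (\<lambda>x. mean (?F x))"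
    unfolding l2_inner_def
  proof (rule arg_cong[where f = mean], rule ext)
    fix x
    note c = cont_funsD[OF section_cont[OF f, of x]]
    show "conv f x * cnj (g x) = mean (?F x)"
      unfolding conv_def by (rule mean_bounded_linear[OF c bounded_linear_mult_left, symmetric])
  qed
  also have "\<dots> = mean (\<lambda>y. mean (\<lambda>x. ?F x y))" by (rule mean_fubini[OF cF])
  also have "\<dots> = mean (\<lambda>y. mean (\<lambda>x. ?H x (- y)))"
  proof (rule arg_cong[where f = mean], rule ext)
    fix y
    have c: "continuous_on UNIV (\<lambda>x. ?F x y)"
      by (intro continuous_on_mult continuous_on_const continuous_on_cnj cont_funsD cont_funs_translate f g)
    from mean_translate[OF c, of "- y"]
    show "mean (\<lambda>x. ?F x y) = mean (\<lambda>x. ?H x (- y))" by (simp add: k_even)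
  qed
  also have "\<dots> = mean (\<lambda>y. mean (\<lambda>x. ?H x y))"
  proof -
    have c: "continuous_on UNIV (\<lambda>y. mean (\<lambda>x. ?H x y))"
      by (rule continuous_mean_param[OF continuous_swap[OF cH]])
    show ?thesis by (rule mean_reflect[OF c])
  qed
  also have "\<dots> = mean (\<lambda>x. mean (?H x))" by (rule mean_fubini[OF cH, symmetric])
  also have "\<dots> = l2_inner f (conv g)"
    unfolding l2_inner_def
  proof (rule arg_cong[where f = mean], rule ext)
    fix x
    note c = cont_funsD[OF section_cont[OF g, of x]]
    have "f x * cnj (conv g x) = mean (\<lambda>y. f x * cnj (complex_of_real (k y) * g (x + y)))"
      unfolding conv_def
      by (rule mean_bounded_linear[OF c, symmetric])
        (rule bounded_linear_compose[OF bounded_linear_mult_right bounded_linear_cnj])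
    then show "mean (?H x) = f x * cnj (conv g x)" by (simp add: mult_ac)
  qed
  finally show ?thesis .
qed

text \<open>Both the bound and the equicontinuity of \<open>conv f\<close> are instances, with \<open>w\<close> a shift of the kernel
  or a difference of two shifts.\<close>

lemma norm_weighted_mean_le:
  fixes f :: "'a \<Rightarrow> complex"
  assumes f: "f \<in> cont_funs" and le: "\<And>y. \<bar>w y\<bar> \<le> C" and w: "continuous_on UNIV w"
  shows "norm (mean (\<lambda>y. complex_of_real (w y) * f y)) \<le> C * l2_norm f"
proof -
  have C: "C \<ge> 0" using le[of 0] by linarith
  note cn = continuous_on_norm[OF cont_funsD[OF f]]
  have "norm (mean (\<lambda>y. complex_of_real (w y) * f y)) \<le> mean (\<lambda>y. C * norm (f y))"
    by (rule norm_mean_le)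
      ((intro continuous_on_mult continuous_on_of_real continuous_on_const cn cont_funsD f w)+,
        simp add: norm_mult le mult_right_mono)
  also have "\<dots> = C * mean (\<lambda>y. norm (f y))"
    by (rule mean_bounded_linear[OF cn bounded_linear_mult_right])
  also have "\<dots> \<le> C * l2_norm f" by (rule mult_left_mono[OF mean_norm_le_l2_norm[OF f] C])
  finally show ?thesis .
qed

lemma k_bounded:
  obtains K where "K > 0" "\<And>x. \<bar>k x\<bar> \<le> K"
  by (rule bounded_cont[OF k_cont]) (rule that, simp_all)

lemma conv_bound:
  assumes f: "f \<in> cont_funs" and K: "\<And>x. \<bar>k x\<bar> \<le> K"
  shows "norm (conv f x) \<le> K * l2_norm f" "l2_norm (conv f) \<le> K * l2_norm f"
proof -
  show 1: "norm (conv f x) \<le> K * l2_norm f" for x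
    unfolding conv_shifted[OF f] diff_conv_add_uminus by (rule norm_weighted_mean_le[OF f K k_shift_cont])
  show "l2_norm (conv f) \<le> K * l2_norm f" by (rule l2_norm_le_sup[OF conv_cont[OF f] 1])
qed

lemma conv_equicontinuous:
  assumes e: "e > 0"
  obtains U where "open U" "0 \<in> U"
    "\<And>f u x. f \<in> cont_funs \<Longrightarrow> u \<in> U \<Longrightarrow> norm (conv f (x + u) - conv f x) \<le> e * l2_norm f"
proof -
  obtain U where U: "open U" "0 \<in> U" "\<And>x u. u \<in> U \<Longrightarrow> dist (k (x + u)) (k x) \<le> e"
    by (rule uniformly_cont[OF k_cont e]) (rule that)
  show ?thesis
  proof (rule that[OF U(1,2)])
    fix f :: "'a \<Rightarrow> complex" and u x assume f: "f \<in> cont_funs" and u: "u \<in> U"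
    have c: "continuous_on UNIV (\<lambda>y. complex_of_real (k (y + - z)) * f y)" for z
      by (intro continuous_on_mult continuous_on_of_real k_shift_cont cont_funsD f)
    have "conv f (x + u) - conv f x = mean (\<lambda>y. complex_of_real (k (y + - (x + u)) - k (y + - x)) * f y)"
      unfolding conv_shifted[OF f] diff_conv_add_uminus[of _ "x + u"] diff_conv_add_uminus[of _ x]
        mean_diff[OF c c, symmetric]
      by (simp only: of_real_diff left_diff_distrib)
    also have "norm \<dots> \<le> e * l2_norm f"
    proof (rule norm_weighted_mean_le[OF f])
      show "continuous_on UNIV (\<lambda>y. k (y + - (x + u)) - k (y + - x))"
        by (intro continuous_on_diff k_shift_cont)
      fix y
      show "\<bar>k (y + - (x + u)) - k (y + - x)\<bar> \<le> e"
        using U(3)[OF u, of "y + - (x + u)"] by (simp add: dist_real_def abs_minus_commute)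
    qed
    finally show "norm (conv f (x + u) - conv f x) \<le> e * l2_norm f" .
  qed
qed

lemma conv_compact:
  assumes f: "\<And>n. f n \<in> cont_funs" and le: "\<And>n. l2_norm (f n) \<le> 1"
  obtains g r where "strict_mono (r :: nat \<Rightarrow> nat)" "g \<in> cont_funs"
    "\<And>e. e > 0 \<Longrightarrow> \<exists>N. \<forall>n\<ge>N. \<forall>x. norm (conv (f (r n)) x - g x) \<le> e"
proof -
  obtain K where K: "K > 0" "\<And>x. \<bar>k x\<bar> \<le> K" by (rule k_bounded) (rule that)
  have bd: "norm (conv (f n) x) \<le> K" for n x
    using conv_bound(1)[OF f K(2), of n x] mult_left_le[OF le[of n], of K] K(1) by linarith
  have eq: "\<exists>U. open U \<and> 0 \<in> U \<and> (\<forall>n. \<forall>u\<in>U. \<forall>x. norm (conv (f n) (x + u) - conv (f n) x) \<le> e)"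
    if e: "e > 0" for e
  proof -
    obtain U where U: "open U" "0 \<in> U"
      "\<And>f u x. f \<in> cont_funs \<Longrightarrow> u \<in> U \<Longrightarrow> norm (conv f (x + u) - conv f x) \<le> e * l2_norm f"
      by (rule conv_equicontinuous[OF e]) (rule that)
    have "norm (conv (f n) (x + u) - conv (f n) x) \<le> e" if "u \<in> U" for n u x
      using U(3)[OF f that, of n x] mult_left_le[OF le[of n], of e] e by linarith
    then show ?thesis using U(1,2) by blast
  qed
  show ?thesis
    by (rule arzela_ascoli_sequence[where h = "\<lambda>n. conv (f n)", OF conv_cont[OF f] bd eq]) (assumption, rule that)
qed

end

section \<open>Varieties on a compact group\<close>

text \<open>On a compact group this is closedness in the topology of uniform convergence on compact sets
  (\<open>closedin_iff_unif_closed\<close>), in the form in which limits are used below.\<close>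

definition unif_closed :: "('a::topological_space \<Rightarrow> complex) set \<Rightarrow> bool" where
  "unif_closed W \<longleftrightarrow> W \<subseteq> cont_funs \<and>
     (\<forall>g\<in>cont_funs. (\<forall>e>0. \<exists>f\<in>W. \<forall>x. norm (f x - g x) \<le> e) \<longrightarrow> g \<in> W)"

lemma unif_closedD:
  assumes "unif_closed W" "g \<in> cont_funs" "\<And>e. e > 0 \<Longrightarrow> \<exists>f\<in>W. \<forall>x. norm (f x - g x) \<le> e"
  shows "g \<in> W"
  using assms unfolding unif_closed_def by blast

lemma (in compact_ab_group) closedin_iff_unif_closed:
  fixes W :: "('a \<Rightarrow> complex) set"
  shows "closedin cont_funs_topology W \<longleftrightarrow> unif_closed W"
proof
  assume cl: "closedin cont_funs_topology W"
  then have sub: "W \<subseteq> cont_funs" using closedin_subset by fastforce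
  have op: "openin cont_funs_topology (cont_funs - W)" using cl unfolding closedin_def by simp
  show "unif_closed W"
    unfolding unif_closed_def
  proof (intro conjI ballI impI sub)
    fix g :: "'a \<Rightarrow> complex" assume g: "g \<in> cont_funs" and ap: "\<forall>e>0. \<exists>f\<in>W. \<forall>x. norm (f x - g x) \<le> e"
    show "g \<in> W"
    proof (rule ccontr)
      assume "g \<notin> W"
      then obtain K e where e: "e > 0"
          "{h \<in> cont_funs. \<forall>x\<in>K. dist (h x) (g x) < e} \<subseteq> cont_funs - W"
        using op g unfolding openin_cont_funs_topology by blast
      have "e / 2 > 0" using e(1) by simp
      then obtain f where f: "f \<in> W" "\<forall>x. norm (f x - g x) \<le> e / 2" using ap by blast
      have "dist (f x) (g x) < e" for x
      proof -
        have "dist (f x) (g x) \<le> e / 2" using f(2) by (simp add: dist_norm)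
        then show ?thesis using e(1) by linarith
      qed
      then have "f \<in> cont_funs - W" using e(2) f(1) sub by blast
      then show False using f(1) by blast
    qed
  qed
next
  assume uc: "unif_closed W"
  then have sub: "W \<subseteq> cont_funs" unfolding unif_closed_def by blast
  have "openin cont_funs_topology (cont_funs - W)"
    unfolding openin_cont_funs_topology
  proof (intro conjI ballI Diff_subset)
    fix g :: "'a \<Rightarrow> complex" assume g: "g \<in> cont_funs - W"
    then obtain e where e: "e > 0" "\<forall>f\<in>W. \<exists>x. \<not> norm (f x - g x) \<le> e"
      using uc unfolding unif_closed_def by blast
    have "h \<notin> W" if "\<forall>x\<in>UNIV. dist (h x) (g x) < e" for h
    proof
      assume "h \<in> W"
      then obtain x where "\<not> norm (h x - g x) \<le> e" using e(2) by blast
      moreover have "dist (h x) (g x) < e" using that by blast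
      ultimately show False by (simp add: dist_norm)
    qed
    then have "{h \<in> cont_funs. \<forall>x\<in>UNIV. dist (h x) (g x) < e} \<subseteq> cont_funs - W" by blast
    then show "\<exists>K e. compact K \<and> e > 0 \<and>
        {h \<in> cont_funs. \<forall>x\<in>K. dist (h x) (g x) < e} \<subseteq> cont_funs - W"
      using compact_UNIV e(1) by blast
  qed
  then show "closedin cont_funs_topology W" using sub unfolding closedin_def by simp
qed

lemma subspace_pointwise:
  assumes "cfun.subspace V"
  shows subspace_zero: "(\<lambda>_. 0) \<in> V"
    and subspace_add: "f \<in> V \<Longrightarrow> g \<in> V \<Longrightarrow> (\<lambda>x. f x + g x) \<in> V"
    and subspace_scale: "f \<in> V \<Longrightarrow> (\<lambda>x. c * f x) \<in> V"
    and subspace_diff: "f \<in> V \<Longrightarrow> g \<in> V \<Longrightarrow> (\<lambda>x. f x - g x) \<in> V"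
  using cfun.subspace_0[OF assms] cfun.subspace_add[OF assms, of f g] cfun.subspace_diff[OF assms, of f g]
    cfun.subspace_scale[OF assms, of f c]
  by (simp_all add: zero_fun_def plus_fun_def fun_diff_def)

lemma subspace_sum:
  assumes "cfun.subspace V" "\<And>i. i \<in> I \<Longrightarrow> f i \<in> V"
  shows "(\<lambda>x. \<Sum>i\<in>I. f i x) \<in> V"
proof -
  have "(\<Sum>i\<in>I. f i) \<in> V" using assms by (rule cfun.subspace_sum)
  moreover have "(\<Sum>i\<in>I. f i) = (\<lambda>x. \<Sum>i\<in>I. f i x)" by (rule ext) (rule sum_fun_apply)
  ultimately show ?thesis by simp
qed

lemma subspaceI_pointwise:
  assumes "(\<lambda>_. 0) \<in> V" "\<And>f g. f \<in> V \<Longrightarrow> g \<in> V \<Longrightarrow> (\<lambda>x. f x + g x) \<in> V"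
    "\<And>c f. f \<in> V \<Longrightarrow> (\<lambda>x. c * f x) \<in> V"
  shows "cfun.subspace V"
  unfolding cfun.subspace_def using assms by (simp add: zero_fun_def plus_fun_def)

section \<open>Spectral theory of the convolution operator\<close>

context even_kernel
begin

text \<open>Averaging \<open>k y * f (x + y)\<close> over finitely many \<open>y\<close> gives a linear combination of translates of
  \<open>f\<close>, and suitable averages of this kind converge to \<open>conv f\<close> uniformly in \<open>x\<close>.\<close>

lemma conv_mem_variety:
  assumes sub: "cfun.subspace V" and uc: "unif_closed V"
    and tr: "\<And>f y. f \<in> V \<Longrightarrow> (\<lambda>x. f (x + y)) \<in> V" and f: "f \<in> V"
  shows "conv f \<in> V"
proof -
  have fc: "f \<in> cont_funs" using f uc unfolding unif_closed_def by blast
  show ?thesis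
  proof (rule unif_closedD[OF uc conv_cont[OF fc]])
    fix e :: real assume e: "e > 0"
    let ?F = "\<lambda>x y. complex_of_real (k y) * f (x + y)"
    obtain ys where ys: "\<And>x z. norm (avg ys (?F x) z - mean (?F x)) \<le> e"
      by (rule uniform_mean_approximation[where F = ?F, OF integrand_cont[OF fc] e]) (rule that)
    have "(\<lambda>x. \<Sum>y\<leftarrow>ys. ?F x y) \<in> V"
      by (induction ys) (simp_all add: subspace_zero[OF sub] subspace_add[OF sub] subspace_scale[OF sub] tr f)
    from subspace_scale[OF sub this, of "complex_of_real (inverse (real (length ys)))"]
    have *: "(\<lambda>x. avg ys (?F x) 0) \<in> V" by (simp add: avg_def scaleR_conv_of_real)
    show "\<exists>h\<in>V. \<forall>x. norm (h x - conv f x) \<le> e"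
      unfolding conv_def by (rule bexI[OF _ *]) (intro allI ys)
  qed
qed

text \<open>Let \<open>\<Lambda>\<close> be the norm of the operator on \<open>W\<close>. For a unit vector \<open>f\<close> with \<open>l2_norm (conv f)\<close>
  close to \<open>\<Lambda>\<close>, self-adjointness makes \<open>conv (conv f) - \<Lambda>\<^sup>2 f\<close> small in the inner product norm.
  By compactness the images \<open>conv f\<close> of a maximising sequence converge uniformly along a subsequence,
  to an element of \<open>W\<close>. This limit, and not a limit of the functions \<open>f\<close> themselves, is the
  eigenvector.\<close>

lemma eigenvector_exists:
  assumes sub: "cfun.subspace W" and uc: "unif_closed W" and inv: "\<And>f. f \<in> W \<Longrightarrow> conv f \<in> W"
    and f0: "f0 \<in> W" "l2_norm f0 \<le> 1" "l2_norm (conv f0) \<ge> \<epsilon>" and \<epsilon>: "\<epsilon> > 0"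
  obtains g \<mu> where "g \<in> W" "l2_norm g \<noteq> 0" "\<mu> \<ge> \<epsilon>\<^sup>2" "conv (conv g) = (\<lambda>x. complex_of_real \<mu> * g x)"
proof -
  have Wc: "f \<in> cont_funs" if "f \<in> W" for f using that uc unfolding unif_closed_def by blast
  obtain K where K: "K > 0" "\<And>x. \<bar>k x\<bar> \<le> K" by (rule k_bounded) (rule that)
  define S where "S = (\<lambda>f. l2_norm (conv f)) ` {f \<in> W. l2_norm f \<le> 1}"
  define \<Lambda> where "\<Lambda> = Sup S"
  have bdd: "bdd_above S"
  proof (rule bdd_aboveI[of _ K])
    fix s assume "s \<in> S"
    then obtain f where f: "f \<in> W" "l2_norm f \<le> 1" "s = l2_norm (conv f)" unfolding S_def by blast
    then show "s \<le> K"
      using conv_bound(2)[OF Wc[OF f(1)] K(2)] mult_left_le[OF f(2), of K] K(1) by linarith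
  qed
  have le1: "l2_norm (conv f) \<le> \<Lambda>" if "f \<in> W" "l2_norm f \<le> 1" for f
    unfolding \<Lambda>_def by (rule cSup_upper[OF _ bdd]) (use that in \<open>simp add: S_def\<close>)
  have \<Lambda>: "\<epsilon> \<le> \<Lambda>" using le1[OF f0(1,2)] f0(3) by linarith
  have \<Lambda>0: "\<Lambda> > 0" using \<Lambda> \<epsilon> by linarith
  have le_conv: "l2_norm (conv f) \<le> \<Lambda> * l2_norm f" if f: "f \<in> W" for f
  proof (cases "l2_norm f = 0")
    case True
    then show ?thesis using conv_bound(2)[OF Wc[OF f] K(2)] by simp
  next
    case False
    then have n: "l2_norm f > 0" using l2_norm_sq(2)[OF Wc[OF f]] by simp
    let ?c = "complex_of_real (inverse (l2_norm f))"
    have c: "norm ?c = inverse (l2_norm f)" using n by (simp only: norm_of_real) simp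
    have "l2_norm (\<lambda>x. ?c * f x) \<le> 1"
      unfolding l2_norm_scale[OF Wc[OF f]] c using n by simp
    from le1[OF subspace_scale[OF sub f] this]
    have "inverse (l2_norm f) * l2_norm (conv f) \<le> \<Lambda>"
      unfolding conv_scale[OF Wc[OF f]] l2_norm_scale[OF conv_cont[OF Wc[OF f]]] c .
    then show ?thesis using n by (simp add: field_simps)
  qed
  \<comment> \<open>squares are compared because the defect of \<open>f\<close> as an eigenvector is estimated by squares\<close>
  have near: "\<exists>f. f \<in> W \<and> l2_norm f \<le> 1 \<and> \<Lambda>\<^sup>2 - (l2_norm (conv f))\<^sup>2 \<le> \<delta>\<^sup>2" if \<delta>: "\<delta> > 0" for \<delta>
  proof -
    have "S \<noteq> {}" unfolding S_def using f0 by blast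
    moreover have "\<Lambda> - \<delta>\<^sup>2 / (2 * \<Lambda>) < Sup S" unfolding \<Lambda>_def[symmetric] using \<delta> \<Lambda>0 by simp
    ultimately obtain s where "s \<in> S" and gt: "\<Lambda> - \<delta>\<^sup>2 / (2 * \<Lambda>) < s" using less_cSupD by blast
    then obtain f where f: "f \<in> W" "l2_norm f \<le> 1" and s: "s = l2_norm (conv f)" unfolding S_def by blast
    have s\<Lambda>: "0 \<le> s" "s \<le> \<Lambda>" using le1[OF f] l2_norm_sq(2)[OF conv_cont[OF Wc[OF f(1)]]] unfolding s by simp_all
    have "\<Lambda>\<^sup>2 - s\<^sup>2 = (\<Lambda> - s) * (\<Lambda> + s)" by (simp add: power2_eq_square algebra_simps)
    also have "\<dots> \<le> (\<delta>\<^sup>2 / (2 * \<Lambda>)) * (2 * \<Lambda>)"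
      by (rule mult_mono) (use gt s\<Lambda> \<Lambda>0 in simp_all)
    also have "\<dots> = \<delta>\<^sup>2" using \<Lambda>0 by simp
    finally show ?thesis using f unfolding s by blast
  qed
  have "\<exists>f. f \<in> W \<and> l2_norm f \<le> 1 \<and> \<Lambda>\<^sup>2 - (l2_norm (conv f))\<^sup>2 \<le> (inverse (real (Suc n)))\<^sup>2" for n
    by (rule near) simp
  from choice[OF allI[OF this]] obtain F where
    F: "\<forall>n. F n \<in> W \<and> l2_norm (F n) \<le> 1 \<and> \<Lambda>\<^sup>2 - (l2_norm (conv (F n)))\<^sup>2 \<le> (inverse (real (Suc n)))\<^sup>2" ..
  have Fc: "F n \<in> cont_funs" and F1: "l2_norm (F n) \<le> 1" for n using F Wc by blast+
  obtain g r where g: "strict_mono (r :: nat \<Rightarrow> nat)" "g \<in> cont_funs"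
    "\<And>e. e > 0 \<Longrightarrow> \<exists>N. \<forall>n\<ge>N. \<forall>x. norm (conv (F (r n)) x - g x) \<le> e"
    by (rule conv_compact[of F, OF Fc F1]) (rule that)
  have approx: "\<exists>f\<in>W. l2_norm f \<le> 1 \<and> (\<forall>x. norm (conv f x - g x) \<le> e) \<and> \<Lambda>\<^sup>2 - (l2_norm (conv f))\<^sup>2 \<le> e\<^sup>2"
    if e: "e > 0" for e
  proof -
    obtain N where N: "\<forall>n\<ge>N. \<forall>x. norm (conv (F (r n)) x - g x) \<le> e" using g(3)[OF e] by blast
    obtain M where M: "inverse (real (Suc M)) < e" using reals_Archimedean[OF e] by blast
    define n where "n = r (max N M)"
    have "M \<le> n" using seq_suble[OF g(1), of "max N M"] by (simp add: n_def)
    then have "inverse (real (Suc n)) \<le> inverse (real (Suc M))" by (simp add: le_imp_inverse_le)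
    then have "inverse (real (Suc n)) \<le> e" using M by linarith
    then have "(inverse (real (Suc n)))\<^sup>2 \<le> e\<^sup>2" by (rule power_mono) simp
    moreover have "\<Lambda>\<^sup>2 - (l2_norm (conv (F n)))\<^sup>2 \<le> (inverse (real (Suc n)))\<^sup>2" using F by blast
    ultimately have "\<Lambda>\<^sup>2 - (l2_norm (conv (F n)))\<^sup>2 \<le> e\<^sup>2" by linarith
    moreover have "\<forall>x. norm (conv (F n) x - g x) \<le> e" using N unfolding n_def by simp
    ultimately show ?thesis using F by blast
  qed
  have gW: "g \<in> W"
    by (rule unif_closedD[OF uc g(2)]) (use approx inv in blast)
  have g0: "l2_norm g \<noteq> 0"
  proof
    assume 0: "l2_norm g = 0"
    have "\<Lambda> / 2 > 0" using \<Lambda>0 by simp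
    then obtain f where f: "f \<in> W" "\<forall>x. norm (conv f x - g x) \<le> \<Lambda> / 2" "\<Lambda>\<^sup>2 - (l2_norm (conv f))\<^sup>2 \<le> (\<Lambda> / 2)\<^sup>2"
      using approx by blast
    have "g = (\<lambda>_. 0)" by (rule l2_norm_zeroD[OF g(2) 0])
    then have "l2_norm (conv f) \<le> \<Lambda> / 2" using f(2) by (intro l2_norm_le_sup conv_cont Wc f(1)) simp
    then have "(l2_norm (conv f))\<^sup>2 \<le> (\<Lambda> / 2)\<^sup>2" by (rule power_mono[OF _ l2_norm_sq(2)[OF conv_cont[OF Wc[OF f(1)]]]])
    then have "\<Lambda>\<^sup>2 \<le> 2 * (\<Lambda> / 2)\<^sup>2" using f(3) by linarith
    then show False using \<Lambda>0 by (simp add: power2_eq_square)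
  qed
  let ?\<mu> = "complex_of_real (\<Lambda>\<^sup>2)"
  \<comment> \<open>the defect operator; it commutes with \<open>conv\<close>, so \<open>E (conv f) = conv (E f)\<close> is small with \<open>E f\<close>\<close>
  define E where "E h = (\<lambda>x. conv (conv h) x - ?\<mu> * h x)" for h
  have Ec: "E h \<in> cont_funs" if "h \<in> cont_funs" for h
    unfolding E_def by (intro cont_funs_diff cont_funs_mult cont_funs_const conv_cont that)
  have E_diff: "E (\<lambda>x. p x - q x) = (\<lambda>x. E p x - E q x)" if "p \<in> cont_funs" "q \<in> cont_funs" for p q
    unfolding E_def by (simp add: conv_diff conv_cont that algebra_simps)
  have E_bound: "l2_norm (E h) \<le> (K * K + \<Lambda>\<^sup>2) * l2_norm h" if h: "h \<in> cont_funs" for h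
  proof -
    have "l2_norm (conv (conv h)) \<le> K * (K * l2_norm h)"
      using conv_bound(2)[OF conv_cont[OF h] K(2)] mult_left_mono[OF conv_bound(2)[OF h K(2)], of K] K(1) by linarith
    moreover have "l2_norm (E h) \<le> l2_norm (conv (conv h)) + \<Lambda>\<^sup>2 * l2_norm h"
      using l2_norm_diff_triangle[OF conv_cont[OF conv_cont[OF h]] cont_funs_mult[OF cont_funs_const h], of ?\<mu>]
      unfolding E_def l2_norm_scale[OF h] norm_of_real by simp
    ultimately show ?thesis by (simp add: algebra_simps)
  qed
  have E_small: "l2_norm (E f) \<le> \<Lambda> * e"
    if f: "f \<in> W" "l2_norm f \<le> 1" "\<Lambda>\<^sup>2 - (l2_norm (conv f))\<^sup>2 \<le> e\<^sup>2" and e: "e > 0" for f e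
  proof (rule power2_le_imp_le)
    note fc = Wc[OF f(1)]
    have "l2_inner (conv (conv f)) f = complex_of_real ((l2_norm (conv f))\<^sup>2)"
      using conv_self_adjoint[OF conv_cont[OF fc] fc] l2_inner_self[OF conv_cont[OF fc]] by simp
    then have ipr: "Re (l2_inner (conv (conv f)) (\<lambda>x. ?\<mu> * f x)) = \<Lambda>\<^sup>2 * (l2_norm (conv f))\<^sup>2"
      unfolding l2_inner_scale_right[OF fc conv_cont[OF conv_cont[OF fc]]] by simp
    have "l2_norm (conv (conv f)) \<le> \<Lambda> * l2_norm (conv f)" by (rule le_conv[OF inv[OF f(1)]])
    then have a: "(l2_norm (conv (conv f)))\<^sup>2 \<le> \<Lambda>\<^sup>2 * (l2_norm (conv f))\<^sup>2"
      using power_mono[OF _ l2_norm_sq(2)[OF conv_cont[OF conv_cont[OF fc]]], of "\<Lambda> * l2_norm (conv f)" 2]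
      by (simp add: power_mult_distrib)
    have b: "(\<Lambda>\<^sup>2 * l2_norm f)\<^sup>2 \<le> (\<Lambda>\<^sup>2)\<^sup>2"
      by (rule power_mono) (use f(2) l2_norm_sq(2)[OF fc] in \<open>simp_all add: mult_left_le\<close>)
    have "(l2_norm (E f))\<^sup>2 = (l2_norm (conv (conv f)))\<^sup>2 - 2 * (\<Lambda>\<^sup>2 * (l2_norm (conv f))\<^sup>2) + (\<Lambda>\<^sup>2 * l2_norm f)\<^sup>2"
      unfolding E_def l2_norm_diff_sq[OF conv_cont[OF conv_cont[OF fc]] cont_funs_mult[OF cont_funs_const fc]]
        ipr l2_norm_scale[OF fc] norm_of_real by simp
    also have "\<dots> \<le> \<Lambda>\<^sup>2 * (\<Lambda>\<^sup>2 - (l2_norm (conv f))\<^sup>2)"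
      using a b by (simp add: algebra_simps power2_eq_square[of "\<Lambda>\<^sup>2"])
    also have "\<dots> \<le> \<Lambda>\<^sup>2 * e\<^sup>2" by (rule mult_left_mono[OF f(3)]) simp
    finally show "(l2_norm (E f))\<^sup>2 \<le> (\<Lambda> * e)\<^sup>2" by (simp add: power_mult_distrib)
    show "0 \<le> \<Lambda> * e" using \<Lambda>0 e by simp
  qed
  have E_limit: "l2_norm (E g) \<le> (K * K + \<Lambda>\<^sup>2 + K * \<Lambda>) * e" if e: "e > 0" for e
  proof -
    obtain f where f: "f \<in> W" "l2_norm f \<le> 1" "\<forall>x. norm (conv f x - g x) \<le> e" "\<Lambda>\<^sup>2 - (l2_norm (conv f))\<^sup>2 \<le> e\<^sup>2"
      using approx[OF e] by blast
    note fc = Wc[OF f(1)]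
    let ?d = "\<lambda>x. conv f x - g x"
    have dc: "?d \<in> cont_funs" by (rule cont_funs_diff[OF conv_cont[OF fc] g(2)])
    have "E (conv f) = conv (E f)"
      unfolding E_def conv_diff[OF conv_cont[OF conv_cont[OF fc]] cont_funs_mult[OF cont_funs_const fc]] conv_scale[OF fc] ..
    then have "l2_norm (E (conv f)) \<le> K * l2_norm (E f)" using conv_bound(2)[OF Ec[OF fc] K(2)] by simp
    also have "\<dots> \<le> K * (\<Lambda> * e)"
      using E_small[OF f(1,2,4) e] K(1) by (intro mult_left_mono) simp_all
    finally have 1: "l2_norm (E (conv f)) \<le> K * (\<Lambda> * e)" .
    have "l2_norm (E ?d) \<le> (K * K + \<Lambda>\<^sup>2) * l2_norm ?d" by (rule E_bound[OF dc])
    also have "\<dots> \<le> (K * K + \<Lambda>\<^sup>2) * e"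
      using f(3) K(1) by (intro mult_left_mono l2_norm_le_sup[OF dc]) simp_all
    finally have 2: "l2_norm (E ?d) \<le> (K * K + \<Lambda>\<^sup>2) * e" .
    have "E g = (\<lambda>x. E (conv f) x - E ?d x)" unfolding E_diff[OF conv_cont[OF fc] g(2)] by simp
    then have "l2_norm (E g) \<le> l2_norm (E (conv f)) + l2_norm (E ?d)"
      using l2_norm_diff_triangle[OF Ec[OF conv_cont[OF fc]] Ec[OF dc]] by simp
    then show ?thesis using 1 2 by (simp add: algebra_simps)
  qed
  have "l2_norm (E g) = 0"
  proof -
    define C where "C = K * K + \<Lambda>\<^sup>2 + K * \<Lambda>"
    have C: "C > 0" using K(1) \<Lambda>0 by (simp add: C_def add_pos_pos)
    have "l2_norm (E g) \<le> 0 + e" if "e > 0" for e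
      using E_limit[of "e / C"] C that by (simp add: C_def)
    then have "l2_norm (E g) \<le> 0" by (rule field_le_epsilon)
    then show ?thesis using l2_norm_sq(2)[OF Ec[OF g(2)]] by simp
  qed
  then have "E g = (\<lambda>_. 0)" by (rule l2_norm_zeroD[OF Ec[OF g(2)]])
  then have "conv (conv g) = (\<lambda>x. complex_of_real (\<Lambda>\<^sup>2) * g x)" by (simp add: E_def fun_eq_iff)
  moreover have "\<epsilon>\<^sup>2 \<le> \<Lambda>\<^sup>2" by (rule power_mono[OF \<Lambda>]) (use \<epsilon> in simp)
  ultimately show ?thesis using that[OF gW g0] by blast
qed

definition eigenset :: "('a \<Rightarrow> complex) set \<Rightarrow> real \<Rightarrow> ('a \<Rightarrow> complex) set \<Rightarrow> bool" where
  "eigenset V \<epsilon> B \<longleftrightarrow> orthonormal B \<and> B \<subseteq> V \<and>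
     (\<forall>b\<in>B. \<exists>\<mu>\<ge>\<epsilon>\<^sup>2. conv (conv b) = (\<lambda>x. complex_of_real \<mu> * b x))"

text \<open>A trace estimate: \<open>conv b x\<close> is an inner product of \<open>b\<close> with a shift of the kernel, so Bessel
  bounds the sum of \<open>|conv b x|\<^sup>2\<close> over \<open>B\<close> by \<open>K\<^sup>2\<close> for every \<open>x\<close>. Taking means over \<open>x\<close>, each \<open>b\<close>
  contributes its eigenvalue, which is at least \<open>\<epsilon>\<^sup>2\<close>.\<close>

lemma card_eigenset_le:
  assumes B: "eigenset V \<epsilon> B" and K: "\<And>x. \<bar>k x\<bar> \<le> K"
  shows "real (card B) * \<epsilon>\<^sup>2 \<le> K\<^sup>2"
proof -
  have on: "orthonormal B" using B unfolding eigenset_def by blast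
  have bc: "b \<in> cont_funs" if "b \<in> B" for b using on that unfolding orthonormal_def by blast
  have eig: "\<epsilon>\<^sup>2 \<le> (l2_norm (conv b))\<^sup>2" if b: "b \<in> B" for b
  proof -
    obtain \<mu> where \<mu>: "\<mu> \<ge> \<epsilon>\<^sup>2" "conv (conv b) = (\<lambda>x. complex_of_real \<mu> * b x)"
      using B b unfolding eigenset_def by blast
    have "l2_inner b b = 1" using on b unfolding orthonormal_def by simp
    then have "l2_inner (conv b) (conv b) = complex_of_real \<mu>"
      using conv_self_adjoint[OF conv_cont[OF bc[OF b]] bc[OF b]]
      unfolding \<mu>(2) l2_inner_scale_left[OF bc[OF b] bc[OF b]] by simp
    then have "complex_of_real ((l2_norm (conv b))\<^sup>2) = complex_of_real \<mu>"
      unfolding l2_inner_self[OF conv_cont[OF bc[OF b]]] .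
    then show ?thesis using \<mu>(1) unfolding of_real_eq_iff by simp
  qed
  have pt: "(\<Sum>b\<in>B. (norm (conv b x))\<^sup>2) \<le> K\<^sup>2" for x
  proof -
    let ?\<kappa> = "\<lambda>y. complex_of_real (k (y + - x))"
    have \<kappa>: "?\<kappa> \<in> cont_funs" by (intro cont_funsI continuous_on_of_real k_shift_cont)
    have "norm (conv b x) = norm (l2_inner ?\<kappa> b)" if b: "b \<in> B" for b
    proof -
      \<comment> \<open>the kernel is real, so no conjugation appears\<close>
      have "conv b x = l2_inner b ?\<kappa>"
        unfolding conv_shifted[OF bc[OF b]] l2_inner_def by (simp add: mult.commute)
      then show ?thesis using l2_inner_cnj[OF bc[OF b] \<kappa>] by (metis complex_mod_cnj)
    qed
    then have "(\<Sum>b\<in>B. (norm (conv b x))\<^sup>2) = (\<Sum>b\<in>B. (norm (l2_inner ?\<kappa> b))\<^sup>2)" by simp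
    also have "\<dots> \<le> (l2_norm ?\<kappa>)\<^sup>2" by (rule bessel[OF on \<kappa>])
    also have "\<dots> \<le> K\<^sup>2"
      by (rule power_mono[OF l2_norm_le_sup[OF \<kappa>] l2_norm_sq(2)[OF \<kappa>]]) (simp add: K)
    finally show ?thesis .
  qed
  have hm: "has_mean (\<lambda>x. \<Sum>b\<in>B. (norm (conv b x))\<^sup>2) (\<Sum>b\<in>B. (l2_norm (conv b))\<^sup>2)"
  proof (rule has_mean_sum)
    fix b assume b: "b \<in> B"
    show "has_mean (\<lambda>x. (norm (conv b x))\<^sup>2) ((l2_norm (conv b))\<^sup>2)"
      unfolding l2_norm_sq(1)[OF conv_cont[OF bc[OF b]]]
      by (rule has_mean_mean[OF cont_norm_sq[OF conv_cont[OF bc[OF b]]]])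
  qed
  have "norm (\<Sum>b\<in>B. (l2_norm (conv b))\<^sup>2) \<le> K\<^sup>2"
    by (rule norm_has_mean_le[OF hm has_mean_const]) (use pt in \<open>simp add: sum_nonneg\<close>)
  moreover have "(\<Sum>b\<in>B. \<epsilon>\<^sup>2) \<le> (\<Sum>b\<in>B. (l2_norm (conv b))\<^sup>2)" by (rule sum_mono[OF eig])
  ultimately show ?thesis by simp
qed

text \<open>Eigenvectors for different eigenvalues are orthogonal, so projecting \<open>g\<close> to the span of \<open>B\<close> only
  involves the \<open>b \<in> B\<close> with the same eigenvalue as \<open>g\<close>. The residual is therefore again an
  eigenvector, orthogonal to \<open>B\<close>; if it were nonzero, its normalisation would enlarge \<open>B\<close>.\<close>

lemma eigenvector_in_span_of_maximal:
  assumes sub: "cfun.subspace V" and Vc: "V \<subseteq> cont_funs"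
    and B: "eigenset V \<epsilon> B" and max: "\<And>C. eigenset V \<epsilon> C \<Longrightarrow> card C \<le> card B"
    and g: "g \<in> V" and \<mu>: "\<mu> \<ge> \<epsilon>\<^sup>2" "conv (conv g) = (\<lambda>x. complex_of_real \<mu> * g x)"
  shows "g \<in> cfun.span B"
proof (rule ccontr)
  assume notin: "g \<notin> cfun.span B"
  have on: "orthonormal B" and BV: "B \<subseteq> V" using B unfolding eigenset_def by blast+
  have fin: "finite B" using on unfolding orthonormal_def by blast
  have gc: "g \<in> cont_funs" using g Vc by blast
  have bc: "b \<in> cont_funs" if "b \<in> B" for b using on that unfolding orthonormal_def by blast
  let ?p = "proj B g"
  define R where "R = (\<lambda>x. g x - ?p x)"
  have pc: "?p \<in> cont_funs" by (rule proj_cont[OF on gc])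
  have Rc: "R \<in> cont_funs" unfolding R_def by (rule residual_cont[OF on gc])
  have l2_inner_term: "l2_inner g b * conv (conv b) x = complex_of_real \<mu> * (l2_inner g b * b x)" if b: "b \<in> B" for b x
  proof -
    obtain \<nu> where \<nu>: "conv (conv b) = (\<lambda>x. complex_of_real \<nu> * b x)"
      using B b unfolding eigenset_def by blast
    have "complex_of_real \<mu> * l2_inner g b = l2_inner (conv (conv g)) b"
      unfolding \<mu>(2) l2_inner_scale_left[OF gc bc[OF b]] ..
    also have "\<dots> = l2_inner g (conv (conv b))"
      by (simp add: conv_self_adjoint conv_cont gc bc[OF b])
    also have "\<dots> = complex_of_real \<nu> * l2_inner g b"
      unfolding \<nu> l2_inner_scale_right[OF bc[OF b] gc] by simp
    finally show ?thesis unfolding \<nu> by (auto simp: mult_ac)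
  qed
  have "conv (conv ?p) = (\<lambda>x. \<Sum>b\<in>B. l2_inner g b * conv (conv b) x)"
  proof -
    have "conv ?p = (\<lambda>x. \<Sum>b\<in>B. conv (\<lambda>x. l2_inner g b * b x) x)"
      unfolding proj_def[abs_def] by (rule conv_sum) (intro cont_funs_mult cont_funs_const bc)
    also have "\<dots> = (\<lambda>x. \<Sum>b\<in>B. l2_inner g b * conv b x)" by (simp add: conv_scale bc)
    finally have "conv (conv ?p) = conv (\<lambda>x. \<Sum>b\<in>B. l2_inner g b * conv b x)" by simp
    also have "\<dots> = (\<lambda>x. \<Sum>b\<in>B. conv (\<lambda>x. l2_inner g b * conv b x) x)"
      by (rule conv_sum) (intro cont_funs_mult cont_funs_const conv_cont bc)
    also have "\<dots> = (\<lambda>x. \<Sum>b\<in>B. l2_inner g b * conv (conv b) x)" by (simp add: conv_scale conv_cont bc)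
    finally show ?thesis .
  qed
  also have "\<dots> = (\<lambda>x. complex_of_real \<mu> * ?p x)"
    unfolding proj_def sum_distrib_left by (intro ext sum.cong refl l2_inner_term)
  finally have conv2p: "conv (conv ?p) = (\<lambda>x. complex_of_real \<mu> * ?p x)" .
  have conv2R: "conv (conv R) = (\<lambda>x. complex_of_real \<mu> * R x)"
    unfolding R_def conv_diff[OF gc pc] conv_diff[OF conv_cont[OF gc] conv_cont[OF pc]] \<mu>(2) conv2p right_diff_distrib ..
  have n: "l2_norm R > 0"
  proof -
    have "l2_norm R \<noteq> 0"
    proof
      assume "l2_norm R = 0"
      then have "R = (\<lambda>_. 0)" by (rule l2_norm_zeroD[OF Rc])
      then have "g = ?p" by (simp add: R_def fun_eq_iff)
      then show False using notin proj_in_span[OF fin, of g] by simp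
    qed
    then show ?thesis using l2_norm_sq(2)[OF Rc] by simp
  qed
  have "?p \<in> V" unfolding proj_def[abs_def] using BV by (intro subspace_sum[OF sub] subspace_scale[OF sub]) blast
  then have RV: "R \<in> V" unfolding R_def by (rule subspace_diff[OF sub g])
  let ?c = "complex_of_real (inverse (l2_norm R))"
  define b0 where "b0 = (\<lambda>x. ?c * R x)"
  have b0c: "b0 \<in> cont_funs" unfolding b0_def by (rule cont_funs_mult[OF cont_funs_const Rc])
  have b0b: "l2_inner b0 b = 0" "l2_inner b b0 = 0" if b: "b \<in> B" for b
  proof -
    have "l2_inner R b = 0" unfolding R_def by (rule l2_inner_residual[OF on gc b])
    then show "l2_inner b0 b = 0"
      unfolding b0_def l2_inner_scale_left[OF Rc bc[OF b]] by simp
    then show "l2_inner b b0 = 0" using l2_inner_cnj[OF b0c bc[OF b]] by simp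
  qed
  have b0b0: "l2_inner b0 b0 = 1"
  proof -
    have "norm ?c = inverse (l2_norm R)" using n by (simp only: norm_of_real) simp
    then have "l2_norm b0 = 1" unfolding b0_def l2_norm_scale[OF Rc] using n by simp
    then show ?thesis using l2_inner_self[OF b0c] by simp
  qed
  have b0B: "b0 \<notin> B" using b0b(1)[of b0] b0b0 by auto
  have "orthonormal (insert b0 B)"
    unfolding orthonormal_def
  proof (intro conjI ballI)
    show "finite (insert b0 B)" using fin by simp
    show "insert b0 B \<subseteq> cont_funs" using b0c bc by blast
    fix b c assume "b \<in> insert b0 B" "c \<in> insert b0 B"
    moreover have "l2_inner b c = (if b = c then 1 else 0)" if "b \<in> B" "c \<in> B"
      using on that unfolding orthonormal_def by blast
    ultimately show "l2_inner b c = (if b = c then 1 else 0)"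
      using b0b b0b0 b0B by (elim insertE) (simp_all, metis+)
  qed
  moreover have "insert b0 B \<subseteq> V" using BV subspace_scale[OF sub RV] unfolding b0_def by blast
  moreover have "conv (conv b0) = (\<lambda>x. complex_of_real \<mu> * b0 x)"
    unfolding b0_def conv_scale[OF Rc] conv_scale[OF conv_cont[OF Rc]] conv2R by (simp add: mult_ac)
  ultimately have "eigenset V \<epsilon> (insert b0 B)"
    using B \<mu>(1) unfolding eigenset_def by blast
  from max[OF this] show False using b0B fin by simp
qed

text \<open>Take \<open>B\<close> of largest size. Translates and images under \<open>conv\<close> of an element of \<open>B\<close> are
  solve the same eigenvalue equation, so they lie in the span of \<open>B\<close> by the previous lemma.
  On the orthogonal complement \<open>W\<close> of \<open>B\<close> in \<open>V\<close> a norm above \<open>\<epsilon>\<close> would yield an eigenvector in \<open>W\<close>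
  that also lies in the span of \<open>B\<close>.\<close>

lemma spectral_decomposition:
  assumes V: "variety V" and \<epsilon>: "\<epsilon> > 0"
  obtains B where "orthonormal B" "subvariety (cfun.span B) V"
    "\<And>s. s \<in> cfun.span B \<Longrightarrow> conv s \<in> cfun.span B"
    "\<And>f. f \<in> V \<Longrightarrow> l2_norm (conv (\<lambda>x. f x - proj B f x)) \<le> \<epsilon> * l2_norm f"
proof -
  have sub: "cfun.subspace V" and uc: "unif_closed V"
    and tr: "\<And>f y. f \<in> V \<Longrightarrow> (\<lambda>x. f (x + y)) \<in> V"
    using V unfolding variety_def closedin_iff_unif_closed by blast+
  have Vc: "V \<subseteq> cont_funs" using uc unfolding unif_closed_def by blast
  have TV: "conv f \<in> V" if "f \<in> V" for f by (rule conv_mem_variety[OF sub uc tr that])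
  obtain K where K: "K > 0" "\<And>x. \<bar>k x\<bar> \<le> K" by (rule k_bounded) (rule that)
  have bound: "card C \<le> nat \<lceil>K\<^sup>2 / \<epsilon>\<^sup>2\<rceil>" if "eigenset V \<epsilon> C" for C
  proof -
    have "real (card C) \<le> K\<^sup>2 / \<epsilon>\<^sup>2"
      using card_eigenset_le[OF that K(2)] \<epsilon> by (simp add: field_simps)
    then show ?thesis by linarith
  qed
  have "eigenset V \<epsilon> {}" unfolding eigenset_def orthonormal_def by simp
  then have "\<exists>B. eigenset V \<epsilon> B \<and> (\<forall>C. eigenset V \<epsilon> C \<longrightarrow> card C \<le> card B)"
    by (rule ex_has_greatest_nat[where b = "Suc (nat \<lceil>K\<^sup>2 / \<epsilon>\<^sup>2\<rceil>)"])
      (simp add: less_Suc_eq_le bound)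
  then obtain B where B: "eigenset V \<epsilon> B" and "\<forall>C. eigenset V \<epsilon> C \<longrightarrow> card C \<le> card B"
    by (elim exE conjE)
  then have max: "card C \<le> card B" if "eigenset V \<epsilon> C" for C using that by blast
  have on: "orthonormal B" and BV: "B \<subseteq> V" using B unfolding eigenset_def by blast+
  have fin: "finite B" using on unfolding orthonormal_def by blast
  have bc: "b \<in> cont_funs" if "b \<in> B" for b using BV Vc that by blast
  have in_span: "g \<in> cfun.span B"
    if "g \<in> V" "\<mu> \<ge> \<epsilon>\<^sup>2" "conv (conv g) = (\<lambda>x. complex_of_real \<mu> * g x)" for g \<mu>
    by (rule eigenvector_in_span_of_maximal[OF sub Vc B _ that]) (rule max)
  have spanV: "cfun.span B \<subseteq> V" using BV sub by (rule cfun.span_minimal)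
  have ssub: "cfun.subspace (cfun.span B)" by (rule cfun.subspace_span)
  have eig: "\<exists>\<mu>\<ge>\<epsilon>\<^sup>2. conv (conv b) = (\<lambda>x. complex_of_real \<mu> * b x)" if "b \<in> B" for b
    using B that unfolding eigenset_def by blast
  have Tspan: "conv s \<in> cfun.span B" if "s \<in> cfun.span B" for s
  proof -
    have Tb: "conv b \<in> cfun.span B" if b: "b \<in> B" for b
    proof -
      obtain \<mu> where \<mu>: "\<mu> \<ge> \<epsilon>\<^sup>2" "conv (conv b) = (\<lambda>x. complex_of_real \<mu> * b x)" using eig[OF b] by blast
      have "conv b \<in> V" using BV b TV by blast
      moreover have "conv (conv (conv b)) = (\<lambda>x. complex_of_real \<mu> * conv b x)" unfolding \<mu>(2) conv_scale[OF bc[OF b]] ..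
      ultimately show ?thesis by (rule in_span[OF _ \<mu>(1)])
    qed
    from iffD1[OF span_finite_pointwise[OF fin] that]
    obtain u where u: "s = (\<lambda>x. \<Sum>b\<in>B. u b * b x)" ..
    have "conv s = (\<lambda>x. \<Sum>b\<in>B. conv (\<lambda>x. u b * b x) x)"
      unfolding u by (rule conv_sum) (intro cont_funs_mult cont_funs_const bc)
    also have "\<dots> = (\<lambda>x. \<Sum>b\<in>B. u b * conv b x)" by (simp add: conv_scale bc)
    also have "\<dots> \<in> cfun.span B" by (intro subspace_sum[OF ssub] subspace_scale[OF ssub] Tb)
    finally show ?thesis .
  qed
  have trspan: "(\<lambda>x. s (x + y)) \<in> cfun.span B" if "s \<in> cfun.span B" for s y
  proof -
    have tb: "(\<lambda>x. b (x + y)) \<in> cfun.span B" if b: "b \<in> B" for b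
    proof -
      obtain \<mu> where \<mu>: "\<mu> \<ge> \<epsilon>\<^sup>2" "conv (conv b) = (\<lambda>x. complex_of_real \<mu> * b x)" using eig[OF b] by blast
      have "(\<lambda>x. b (x + y)) \<in> V" using BV b tr by blast
      moreover have "conv (conv (\<lambda>x. b (x + y))) = (\<lambda>x. complex_of_real \<mu> * b (x + y))"
        unfolding conv_translate[of b] conv_translate[of "conv b"] \<mu>(2) ..
      ultimately show ?thesis by (rule in_span[OF _ \<mu>(1)])
    qed
    from iffD1[OF span_finite_pointwise[OF fin] that]
    obtain u where u: "s = (\<lambda>x. \<Sum>b\<in>B. u b * b x)" ..
    show ?thesis unfolding u by (intro subspace_sum[OF ssub] subspace_scale[OF ssub] tb)
  qed
  have ucspan: "unif_closed (cfun.span B)"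
    unfolding unif_closed_def
  proof (intro conjI ballI impI)
    show "cfun.span B \<subseteq> cont_funs" using spanV Vc by blast
    fix g :: "'a \<Rightarrow> complex"
    assume g: "g \<in> cont_funs" and ap: "\<forall>e>0. \<exists>s\<in>cfun.span B. \<forall>x. norm (s x - g x) \<le> e"
    note rc = residual_cont[OF on g]
    have "l2_norm (\<lambda>x. g x - proj B g x) \<le> 0 + e" if "e > 0" for e
    proof -
      obtain s where s: "s \<in> cfun.span B" "\<forall>x. norm (s x - g x) \<le> e" using ap \<open>e > 0\<close> by blast
      have "l2_norm (\<lambda>x. g x - proj B g x) \<le> l2_norm (\<lambda>x. g x - s x)"
        by (rule l2_norm_residual_le_dist[OF on g s(1)])
      also have "\<dots> \<le> e"
        using s spanV Vc by (intro l2_norm_le_sup cont_funs_diff g) (auto simp: norm_minus_commute)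
      finally show ?thesis by simp
    qed
    then have "l2_norm (\<lambda>x. g x - proj B g x) \<le> 0" by (rule field_le_epsilon)
    then have "(\<lambda>x. g x - proj B g x) = (\<lambda>_. 0)"
      using l2_norm_sq(2)[OF rc] by (intro l2_norm_zeroD[OF rc]) simp
    then have "g = proj B g" by (simp add: fun_eq_iff)
    then show "g \<in> cfun.span B" using proj_in_span[OF fin, of g] by simp
  qed
  have subvar: "subvariety (cfun.span B) V"
    unfolding subvariety_def variety_def closedin_iff_unif_closed
    using ssub ucspan trspan spanV by blast
  define W where "W = {w \<in> V. \<forall>b\<in>B. l2_inner w b = 0}"
  have Wc: "w \<in> cont_funs" if "w \<in> W" for w using that Vc unfolding W_def by blast
  have orth_span: "l2_inner w s = 0" if w: "w \<in> W" and s: "s \<in> cfun.span B" for w s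
  proof -
    have wV: "w \<in> V" and wb: "l2_inner w b = 0" if "b \<in> B" for b using w that unfolding W_def by blast+
    from iffD1[OF span_finite_pointwise[OF fin] s]
    obtain u where u: "s = (\<lambda>x. \<Sum>b\<in>B. u b * b x)" ..
    have bw: "l2_inner b w = 0" if "b \<in> B" for b using l2_inner_cnj[OF Wc[OF w] bc[OF that]] wb[OF that] by simp
    have sc: "s \<in> cont_funs" using s spanV Vc by blast
    have "l2_inner s w = 0"
      unfolding u
      by (subst l2_inner_sum_left[OF cont_funs_mult[OF cont_funs_const bc] Wc[OF w]])
        (simp_all add: l2_inner_scale_left[OF bc Wc[OF w]] bw)
    then show ?thesis using l2_inner_cnj[OF sc Wc[OF w]] by simp
  qed
  have Wsub: "cfun.subspace W"
  proof (rule subspaceI_pointwise)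
    show "(\<lambda>_. 0) \<in> W" unfolding W_def by (simp add: subspace_zero[OF sub] l2_inner_def)
    show "(\<lambda>x. f x + g x) \<in> W" if "f \<in> W" "g \<in> W" for f g
      using that Wc[OF that(1)] Wc[OF that(2)] unfolding W_def
      by (simp add: subspace_add[OF sub] l2_inner_add_left bc)
    show "(\<lambda>x. c * f x) \<in> W" if "f \<in> W" for c f
      using that Wc[OF that] unfolding W_def by (simp add: subspace_scale[OF sub] l2_inner_scale_left bc)
  qed
  have Wuc: "unif_closed W"
    unfolding unif_closed_def
  proof (intro conjI ballI impI)
    show "W \<subseteq> cont_funs" using Wc by blast
    fix g :: "'a \<Rightarrow> complex"
    assume g: "g \<in> cont_funs" and ap: "\<forall>e>0. \<exists>f\<in>W. \<forall>x. norm (f x - g x) \<le> e"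
    have gV: "g \<in> V" by (rule unif_closedD[OF uc g]) (use ap in \<open>unfold W_def, blast\<close>)
    have "l2_inner g b = 0" if b: "b \<in> B" for b
    proof -
      have "norm (l2_inner g b) \<le> 0 + e" if "e > 0" for e
      proof -
        obtain f where f: "f \<in> W" "\<forall>x. norm (f x - g x) \<le> e" using ap \<open>e > 0\<close> by blast
        have dc: "(\<lambda>x. f x - g x) \<in> cont_funs" by (rule cont_funs_diff[OF Wc[OF f(1)] g])
        have "l2_inner b b = 1" using on b unfolding orthonormal_def by simp
        then have "(l2_norm b)\<^sup>2 = 1" using l2_inner_self[OF bc[OF b]] by (metis of_real_1 of_real_eq_iff)
        then have b1: "l2_norm b = 1" using l2_norm_sq(2)[OF bc[OF b]] by (simp add: power2_eq_1_iff)
        have "l2_inner (\<lambda>x. f x - g x) b = - l2_inner g b"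
          using f(1) b unfolding l2_inner_diff_left[OF Wc[OF f(1)] g bc[OF b]] W_def by simp
        then have "norm (l2_inner g b) \<le> l2_norm (\<lambda>x. f x - g x) * l2_norm b"
          using norm_l2_inner_le[OF dc bc[OF b]] by simp
        also have "\<dots> \<le> e" using l2_norm_le_sup[OF dc] f(2) b1 by simp
        finally show ?thesis by simp
      qed
      then have "norm (l2_inner g b) \<le> 0" by (rule field_le_epsilon)
      then show ?thesis by simp
    qed
    then show "g \<in> W" unfolding W_def using gV by blast
  qed
  have TW: "conv w \<in> W" if w: "w \<in> W" for w
  proof -
    have "l2_inner (conv w) b = 0" if b: "b \<in> B" for b
      unfolding conv_self_adjoint[OF Wc[OF w] bc[OF b]]
      by (rule orth_span[OF w Tspan[OF cfun.span_base[OF b]]])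
    moreover have "conv w \<in> V" using w TV unfolding W_def by blast
    ultimately show ?thesis unfolding W_def by blast
  qed
  have small: "l2_norm (conv w) \<le> \<epsilon> * l2_norm w" if w: "w \<in> W" for w
  proof (rule ccontr)
    assume neg: "\<not> l2_norm (conv w) \<le> \<epsilon> * l2_norm w"
    have "l2_norm w \<noteq> 0"
      using neg conv_bound(2)[OF Wc[OF w] K(2)] l2_norm_sq(2)[OF conv_cont[OF Wc[OF w]]] by auto
    then have n: "l2_norm w > 0" using l2_norm_sq(2)[OF Wc[OF w]] by simp
    let ?c = "complex_of_real (inverse (l2_norm w))"
    have c: "norm ?c = inverse (l2_norm w)" using n by (simp only: norm_of_real) simp
    have 1: "l2_norm (\<lambda>x. ?c * w x) \<le> 1" unfolding l2_norm_scale[OF Wc[OF w]] c using n by simp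
    have 2: "l2_norm (conv (\<lambda>x. ?c * w x)) \<ge> \<epsilon>"
      unfolding conv_scale[OF Wc[OF w]] l2_norm_scale[OF conv_cont[OF Wc[OF w]]] c
      using neg n by (simp add: field_simps)
    obtain g \<mu> where g: "g \<in> W" "l2_norm g \<noteq> 0" "\<mu> \<ge> \<epsilon>\<^sup>2" "conv (conv g) = (\<lambda>x. complex_of_real \<mu> * g x)"
      by (rule eigenvector_exists[OF Wsub Wuc TW subspace_scale[OF Wsub w] 1 2 \<epsilon>]) (assumption, rule that)
    have gV: "g \<in> V" using g(1) unfolding W_def by blast
    have "l2_inner g g = 0" by (rule orth_span[OF g(1) in_span[OF gV g(3,4)]])
    then show False using g(2) l2_inner_self[OF Wc[OF g(1)]] by simp
  qed
  show ?thesis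
  proof (rule that[OF on subvar Tspan])
    fix f assume f: "f \<in> V"
    have fc: "f \<in> cont_funs" using f Vc by blast
    have "proj B f \<in> V" using proj_in_span[OF fin] spanV by blast
    then have "(\<lambda>x. f x - proj B f x) \<in> V" by (rule subspace_diff[OF sub f])
    then have "(\<lambda>x. f x - proj B f x) \<in> W"
      unfolding W_def using l2_inner_residual[OF on fc] by blast
    from small[OF this] show "l2_norm (conv (\<lambda>x. f x - proj B f x)) \<le> \<epsilon> * l2_norm f"
      using mult_left_mono[OF l2_norm_residual_le[OF on fc], of \<epsilon>] \<epsilon> by linarith
  qed
qed

end

section \<open>Approximate identities and spectral synthesis\<close>

context compact_ab_group
begin

text \<open>With \<open>d y\<close> the supremum distance between \<open>f\<close> and its translate by \<open>y\<close>, the function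
  \<open>max 0 (e - d y)\<close> is continuous, positive at \<open>0\<close> and vanishes where \<open>d y \<ge> e\<close>. It is even because
  \<open>d\<close> is: \<open>f\<close> and its translate by \<open>-y\<close> are at the same distance as the translate by \<open>y\<close> and \<open>f\<close>.\<close>

lemma approximate_identity:
  fixes f :: "'a \<Rightarrow> complex"
  assumes f: "f \<in> cont_funs" and e: "e > 0"
  shows "\<exists>k :: 'a \<Rightarrow> real. continuous_on UNIV k \<and> (\<forall>x. k (- x) = k x) \<and> (\<forall>x. k x \<ge> 0) \<and>
    mean k = 1 \<and> (\<forall>x y. k y \<noteq> 0 \<longrightarrow> norm (f (x + y) - f x) \<le> e)"
proof -
  define d where "d y = (SUP x. norm (f (x + y) - f x))" for y
  obtain C where C: "\<And>x. norm (f x) \<le> C" by (rule bounded_cont[OF cont_funsD[OF f]]) (rule that)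
  have bdd: "bdd_above (range (\<lambda>x. norm (f (x + y) - f x)))" for y
  proof (rule bdd_aboveI2)
    fix x show "norm (f (x + y) - f x) \<le> C + C"
      using norm_triangle_ineq4[of "f (x + y)" "f x"] C[of "x + y"] C[of x] by linarith
  qed
  have d_upper: "norm (f (x + y) - f x) \<le> d y" for x y
    unfolding d_def by (rule cSUP_upper[OF UNIV_I bdd])
  have d_least: "d y \<le> c" if "\<And>x. norm (f (x + y) - f x) \<le> c" for y c
    unfolding d_def by (rule cSUP_least) (simp_all add: that)
  have d_neg: "d (- y) \<le> d y" for y
  proof (rule d_least)
    fix x show "norm (f (x + - y) - f x) \<le> d y"
      using d_upper[of "x - y" y] by (simp add: norm_minus_commute)
  qed
  have d_even: "d (- y) = d y" for y using d_neg[of y] d_neg[of "- y"] by simp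
  have dc: "continuous_on UNIV d"
  proof -
    have c: "continuous_on UNIV (\<lambda>p. f (snd p + fst p))"
      by (rule continuous_on_compose2[OF cont_funsD[OF f]])
        (intro continuous_on_add continuous_on_fst continuous_on_snd continuous_on_id subset_UNIV)+
    have "(d \<longlongrightarrow> d y0) (at y0)" for y0
      unfolding tendsto_iff
    proof (intro allI impI)
      fix r :: real assume r: "r > 0"
      then have "r / 2 > 0" by simp
      obtain U where U: "open U" "y0 \<in> U" "\<And>y x. y \<in> U \<Longrightarrow> dist (f (x + y)) (f (x + y0)) \<le> r / 2"
        by (rule uniform_along_compact[of "\<lambda>y x. f (x + y)", OF c \<open>r / 2 > 0\<close>, of y0]) (rule that)
      have "dist (d y) (d y0) < r" if y: "y \<in> U" for y
      proof -
        have "d y \<le> d y0 + r / 2"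
        proof (rule d_least)
          fix x show "norm (f (x + y) - f x) \<le> d y0 + r / 2"
            using norm_triangle_ineq[of "f (x + y) - f (x + y0)" "f (x + y0) - f x"] d_upper[of x y0] U(3)[OF y, of x]
            by (simp add: dist_norm)
        qed
        moreover have "d y0 \<le> d y + r / 2"
        proof (rule d_least)
          fix x show "norm (f (x + y0) - f x) \<le> d y + r / 2"
            using norm_triangle_ineq[of "f (x + y0) - f (x + y)" "f (x + y) - f x"] d_upper[of x y] U(3)[OF y, of x]
            by (simp add: dist_norm norm_minus_commute)
        qed
        ultimately show ?thesis using r unfolding dist_real_def by linarith
      qed
      then show "\<forall>\<^sub>F y in at y0. dist (d y) (d y0) < r"
        unfolding eventually_at_topological using U(1,2) by blast
    qed
    then show ?thesis by (simp add: continuous_on_def)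
  qed
  define k0 where "k0 y = max 0 (e - d y)" for y
  have k0c: "continuous_on UNIV k0"
    unfolding k0_def[abs_def] by (intro continuous_on_max continuous_on_diff continuous_on_const dc)
  have "d 0 \<le> 0" by (rule d_least) simp
  then have "k0 0 > 0" using e by (simp add: k0_def)
  then have m: "mean k0 > 0" by (intro mean_pos[OF k0c]) (simp_all add: k0_def)
  show ?thesis
  proof (intro exI[of _ "\<lambda>x. k0 x / mean k0"] conjI allI impI)
    show "continuous_on UNIV (\<lambda>x. k0 x / mean k0)"
      using m by (intro continuous_on_divide k0c continuous_on_const) simp
    show "k0 (- x) / mean k0 = k0 x / mean k0" for x by (simp add: k0_def d_even)
    show "k0 x / mean k0 \<ge> 0" for x using m by (simp add: k0_def)
    show "mean (\<lambda>x. k0 x / mean k0) = 1"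
      using mean_bounded_linear[OF k0c bounded_linear_divide[of "mean k0"]] m by simp
    show "norm (f (x + y) - f x) \<le> e" if "k0 y / mean k0 \<noteq> 0" for x y
    proof -
      have "k0 y \<noteq> 0" using that by auto
      then have "d y < e" by (simp add: k0_def max_def split: if_splits)
      then show ?thesis using d_upper[of x y] by linarith
    qed
  qed
qed

lemma variety_approximation:
  fixes f :: "'a \<Rightarrow> complex"
  assumes V: "variety V" and f: "f \<in> V" and e: "e > 0"
  obtains W s where "subvariety W V" "finite_dimensional W" "s \<in> W" "\<And>x. norm (s x - f x) \<le> 3 * e"
proof -
  have Vc: "V \<subseteq> cont_funs" using V closedin_subset unfolding variety_def by fastforce
  have fc: "f \<in> cont_funs" using f Vc by blast
  from approximate_identity[OF fc e] obtain k :: "'a \<Rightarrow> real" where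
    k_all: "continuous_on UNIV k \<and> (\<forall>x. k (- x) = k x) \<and> (\<forall>x. k x \<ge> 0) \<and> mean k = 1 \<and>
      (\<forall>x y. k y \<noteq> 0 \<longrightarrow> norm (f (x + y) - f x) \<le> e)" ..
  have k: "continuous_on UNIV k" "k (- x) = k x" "k x \<ge> 0" "mean k = 1"
    "k y \<noteq> 0 \<Longrightarrow> norm (f (x + y) - f x) \<le> e" for x y
    using k_all by simp_all
  interpret even_kernel G k by unfold_locales (rule k(1), rule k(2))
  have near: "norm (conv f x - f x) \<le> e" for x
  proof -
    have c: "continuous_on UNIV (\<lambda>y. complex_of_real (k y) * f x)"
      by (intro continuous_on_mult continuous_on_of_real k(1) continuous_on_const)
    have "mean (\<lambda>y. complex_of_real (k y) * f x) = complex_of_real (mean k) * f x"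
      by (rule mean_bounded_linear[OF k(1) bounded_linear_compose[OF bounded_linear_mult_left bounded_linear_of_real]])
    then have "conv f x - f x = mean (\<lambda>y. complex_of_real (k y) * f (x + y) - complex_of_real (k y) * f x)"
      unfolding mean_diff[OF cont_funsD[OF section_cont[OF fc]] c] conv_def k(4) by simp
    also have "norm \<dots> \<le> mean (\<lambda>y. e * k y)"
    proof (rule norm_mean_le)
      show "continuous_on UNIV (\<lambda>y. complex_of_real (k y) * f (x + y) - complex_of_real (k y) * f x)"
        by (rule continuous_on_diff[OF cont_funsD[OF section_cont[OF fc]] c])
      show "continuous_on UNIV (\<lambda>y. e * k y)" by (intro continuous_on_mult continuous_on_const k(1))
      fix y
      have "norm (complex_of_real (k y) * f (x + y) - complex_of_real (k y) * f x) = k y * norm (f (x + y) - f x)"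
        unfolding right_diff_distrib[symmetric] norm_mult using k(3) by simp
      also have "\<dots> \<le> k y * e"
        using k(3)[of y] k(5)[of y x] by (cases "k y = 0") (simp_all add: mult_left_mono)
      finally show "norm (complex_of_real (k y) * f (x + y) - complex_of_real (k y) * f x) \<le> e * k y"
        by (simp add: mult.commute)
    qed
    also have "\<dots> = e * mean k" by (rule mean_bounded_linear[OF k(1) bounded_linear_mult_right])
    finally show ?thesis by (simp add: k(4))
  qed
  have contr: "norm (conv h x) \<le> c" if h: "h \<in> cont_funs" and le: "\<And>x. norm (h x) \<le> c" for h x c
  proof -
    have "norm (conv h x) \<le> mean (\<lambda>y. c * k y)"
      unfolding conv_def
    proof (rule norm_mean_le[OF cont_funsD[OF section_cont[OF h]]])
      show "continuous_on UNIV (\<lambda>y. c * k y)" by (intro continuous_on_mult continuous_on_const k(1))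
      show "norm (complex_of_real (k y) * h (x + y)) \<le> c * k y" for y
        using mult_right_mono[OF le[of "x + y"] k(3)[of y]] k(3)[of y] by (simp add: norm_mult mult.commute)
    qed
    also have "\<dots> = c * mean k" by (rule mean_bounded_linear[OF k(1) bounded_linear_mult_right])
    finally show ?thesis by (simp add: k(4))
  qed
  have near2: "norm (conv (conv f) x - f x) \<le> 2 * e" for x
  proof -
    have "norm (conv (\<lambda>x. conv f x - f x) x) \<le> e"
      by (rule contr[OF cont_funs_diff[OF conv_cont[OF fc] fc] near])
    then have "norm (conv (conv f) x - conv f x) \<le> e" unfolding conv_diff[OF conv_cont[OF fc] fc] .
    then show ?thesis
      using near[of x] norm_triangle_ineq[of "conv (conv f) x - conv f x" "conv f x - f x"] by simp
  qed
  obtain K where K: "K > 0" "\<And>x. \<bar>k x\<bar> \<le> K" by (rule k_bounded) (rule that)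
  have n0: "l2_norm f \<ge> 0" by (rule l2_norm_sq(2)[OF fc])
  \<comment> \<open>adding \<open>1\<close> avoids division by zero when \<open>f = 0\<close>\<close>
  define \<epsilon> where "\<epsilon> = e / (K * (l2_norm f + 1))"
  have \<epsilon>: "\<epsilon> > 0" using e K(1) n0 by (simp add: \<epsilon>_def)
  have \<epsilon>e: "K * (\<epsilon> * l2_norm f) \<le> e"
  proof -
    have "K * (\<epsilon> * l2_norm f) = e * (l2_norm f / (l2_norm f + 1))" using K(1) n0 by (simp add: \<epsilon>_def)
    also have "\<dots> \<le> e * 1" using e n0 by (intro mult_left_mono) simp_all
    finally show ?thesis by simp
  qed
  obtain B where B: "orthonormal B" "subvariety (cfun.span B) V"
    "\<And>s. s \<in> cfun.span B \<Longrightarrow> conv s \<in> cfun.span B"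
    "\<And>f. f \<in> V \<Longrightarrow> l2_norm (conv (\<lambda>x. f x - proj B f x)) \<le> \<epsilon> * l2_norm f"
    by (rule spectral_decomposition[OF V \<epsilon>]) (rule that)
  have fin: "finite B" using B(1) unfolding orthonormal_def by blast
  note pc = proj_cont[OF B(1) fc] and rc = residual_cont[OF B(1) fc]
  let ?s = "conv (conv (proj B f))"
  show ?thesis
  proof (rule that[OF B(2)])
    show "finite_dimensional (cfun.span B)" unfolding finite_dimensional_def using fin by blast
    show "?s \<in> cfun.span B" by (intro B(3) proj_in_span fin)
    fix x
    have "norm (conv (conv (\<lambda>x. f x - proj B f x)) x) \<le> K * l2_norm (conv (\<lambda>x. f x - proj B f x))"
      by (rule conv_bound(1)[OF conv_cont[OF rc] K(2)])
    also have "\<dots> \<le> K * (\<epsilon> * l2_norm f)" using B(4)[OF f] K(1) by (intro mult_left_mono) simp_all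
    also have "\<dots> \<le> e" by (rule \<epsilon>e)
    finally have "norm (conv (conv f) x - ?s x) \<le> e"
      unfolding conv_diff[OF fc pc] conv_diff[OF conv_cont[OF fc] conv_cont[OF pc]] .
    then show "norm (?s x - f x) \<le> 3 * e"
      using near2[of x] norm_triangle_ineq[of "?s x - conv (conv f) x" "conv (conv f) x - f x"]
      by (simp add: norm_minus_commute)
  qed
qed

lemma variety_synthesizable:
  fixes V :: "('a \<Rightarrow> complex) set"
  assumes V: "variety V"
  shows "synthesizable V"
proof -
  let ?X = "subtopology cont_funs_topology V"
  let ?D = "cfun.span (\<Union>{W. subvariety W V \<and> finite_dimensional W})"
  have Vc: "V \<subseteq> cont_funs" using V closedin_subset unfolding variety_def by fastforce
  then have top: "topspace ?X = V" by auto
  have "f \<in> ?X closure_of ?D" if f: "f \<in> V" for f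
    unfolding in_closure_of top
  proof (intro conjI allI impI f)
    fix U assume U: "f \<in> U \<and> openin ?X U"
    then obtain U' where U': "openin cont_funs_topology U'" "U = U' \<inter> V"
      unfolding openin_subtopology by blast
    then obtain K e where e: "e > 0" "{g \<in> cont_funs. \<forall>x\<in>K. dist (g x) (f x) < e} \<subseteq> U'"
      using U unfolding openin_cont_funs_topology by blast
    have "e / 4 > 0" using e(1) by simp
    obtain W s where W: "subvariety W V" "finite_dimensional W" "s \<in> W" "\<And>x. norm (s x - f x) \<le> 3 * (e / 4)"
      by (rule variety_approximation[OF V f \<open>e / 4 > 0\<close>]) (rule that)
    have sV: "s \<in> V" using W(1,3) unfolding subvariety_def by blast
    have "dist (s x) (f x) < e" for x using W(4)[of x] e(1) by (simp add: dist_norm)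
    then have "s \<in> U" using e(2) sV Vc unfolding U'(2) by blast
    moreover have "s \<in> ?D" using W(1-3) by (intro cfun.span_base) blast
    ultimately show "\<exists>y. y \<in> ?D \<and> y \<in> U" by blast
  qed
  moreover have "?X closure_of ?D \<subseteq> V" using closure_of_subset_topspace[of ?X ?D] unfolding top .
  ultimately show ?thesis unfolding synthesizable_def by blast
qed

end

theorem corollary2:
  assumes "compact (UNIV :: 'a::{topological_ab_group_add, t2_space} set)"
  shows "spectral_synthesis_on TYPE('a)"
proof -
  interpret compact_ab_group "TYPE('a)" by unfold_locales (rule assms)
  show ?thesis
    unfolding spectral_synthesis_on_def spectral_synthesis_for_def subvariety_def
    using variety_synthesizable by blast
qed

end
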